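(* Let $(g,J,\Omega)$ be a Kähler structure with Levi-Civita connection $D$ and scalar curvature $\mathscr{R}_g$ on a $2n$-dimensional manifold. Then $$2\mathcal{K}(D)=\Delta_g\mathscr{R}_g-|\mathrm{Ric}|_g^2+\tfrac12|\mathrm{Riem}|_g^2,$$ and, for $n\ge 2$, $$2\mathcal{K}(D)=\Delta_g\mathscr{R}_g+\tfrac12|A|_g^2-\tfrac{n-2}{n-1}|E|_g^2-\tfrac{n-1}{n(2n-1)}\mathscr{R}_g^2=L_g\mathscr{R}_g+\tfrac12|A|_g^2-\tfrac{n-2}{n-1}|E|_g^2+\tfrac{(n-1)(n-2)}{2n(2n-1)}\mathscr{R}_g^2,$$ where $\Delta_gf=g^{ij}D_idf_j$ is the Laplacian, $L_g=\Delta_g-\tfrac{n-1}{2(2n-1)}\mathscr{R}_g$ is the conformal Laplacian, $E_{ij}=R_{ij}-\tfrac1{2n}\mathscr{R}_gg_{ij}$ is the trace-free Ricci tensor, and $A_{ijkl}$ is the conformal Weyl tensor $$A_{ijkl}=R_{ijk}{}^pg_{pl}+\tfrac1{n-1}\left(g_{k[i}R_{j]l}-g_{l[i}R_{j]k}\right)-\tfrac1{(n-1)(2n-1)}\mathscr{R}_g\,g_{k[i}g_{j]l},$$ all tensor norms being given by complete contraction with the metric.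
   Context: Abstract index notation is used; square brackets denote antisymmetrization (with averaging factor). Indices are raised and lowered with the symplectic form by $X_i=X^p\Omega_{pi}$, $X^i=\Omega^{ip}X_p$, where $\Omega^{ip}\Omega_{pj}=-\delta_j{}^i$ (but $g^{ij}$ is the inverse of $g_{ij}$). A Kähler structure $(g,J,\Omega)$ is a symplectic form $\Omega$ with an integrable complex structure $J$ such that $g_{ij}=-J_i{}^p\Omega_{pj}$ is symmetric and positive definite; its Levi-Civita connection satisfies $D\Omega=0$. For a torsion-free connection $\nabla$ with $\nabla\Omega=0$: $\nabla_i\nabla_jX^k-\nabla_j\nabla_iX^k=R_{ijp}{}^kX^p$, $R_{ij}=R_{pij}{}^p$, $R_{ijkl}=R_{ijk}{}^p\Omega_{pl}$, and $\mathcal{K}(\nabla)=\nabla^i\nabla^jR_{ij}-\tfrac12R^{ij}R_{ij}+\tfrac14R^{ijkl}R_{ijkl}$ (indices raised with $\Omega$). Here $\mathrm{Riem}=R_{ijk}{}^l$ and $\mathrm{Ric}=R_{ij}$ are the curvature and Ricci tensors of $D$, $\mathscr{R}_g=g^{ij}R_{ij}$. *)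

theory Defs
  imports "HOL-Analysis.Analysis"
begin

abbreviation idx_sum :: "('m::finite \<Rightarrow> real) \<Rightarrow> real"  (binder "\<^bold>\<Sum>" 10)
  where "idx_sum f \<equiv> sum f UNIV"


section \<open>Smooth functions and manifolds\<close>

definition pd :: "'m \<Rightarrow> (real^'m \<Rightarrow> real) \<Rightarrow> real^'m \<Rightarrow> real" where
  "pd i f x = frechet_derivative f (at x) (axis i 1)"

primrec Ck_on :: "nat \<Rightarrow> (real^'m) set \<Rightarrow> (real^'m \<Rightarrow> real) \<Rightarrow> bool" where
  "Ck_on 0 S f \<longleftrightarrow> continuous_on S f"
| "Ck_on (Suc k) S f \<longleftrightarrow> (\<forall>x\<in>S. f differentiable (at x)) \<and> (\<forall>i. Ck_on k S (pd i f))"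

definition smooth_on :: "(real^'m) set \<Rightarrow> (real^'m \<Rightarrow> real) \<Rightarrow> bool" where
  "smooth_on S f \<longleftrightarrow> (\<forall>k. Ck_on k S f)"

text \<open>A chart is a pair of its domain and its coordinate map.\<close>

type_synonym ('a, 'm) chart = "'a set \<times> ('a \<Rightarrow> real^'m)"

definition dom_of :: "('a, 'm) chart \<Rightarrow> 'a set" where
  "dom_of c = fst c"

definition coords :: "('a, 'm) chart \<Rightarrow> 'a \<Rightarrow> real^'m" where
  "coords c = snd c"

definition img_of :: "('a, 'm) chart \<Rightarrow> (real^'m) set" where
  "img_of c = coords c ` dom_of c"

definition transition :: "('a, 'm) chart \<Rightarrow> ('a, 'm) chart \<Rightarrow> real^'m \<Rightarrow> real^'m" where
  "transition c d x = coords d (inv_into (dom_of c) (coords c) x)"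

definition smooth_atlas :: "'a topology \<Rightarrow> ('a, 'm::finite) chart set \<Rightarrow> bool" where
  "smooth_atlas M A \<longleftrightarrow>
     Hausdorff_space M \<and> second_countable M \<and>
     (\<Union>c\<in>A. dom_of c) = topspace M \<and>
     (\<forall>c\<in>A. openin M (dom_of c) \<and> open (img_of c) \<and>
        homeomorphic_map (subtopology M (dom_of c)) (top_of_set (img_of c)) (coords c)) \<and>
     (\<forall>c\<in>A. \<forall>d\<in>A. \<forall>a.
        smooth_on (coords c ` (dom_of c \<inter> dom_of d)) (\<lambda>x. transition c d x $ a))"


section \<open>Tensor fields\<close>

text \<open>
  A tensor field on a manifold is given by its components in every chart of the atlas, as
  functions of the coordinates, subject to the usual transformation law on overlaps.
  Upper and lower indices are both listed in the order in which they are written in abstract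
  index notation; e.g. the endomorphism \<open>J\<^sub>i\<^sup>k\<close> is \<open>J x i k\<close>.
  \<open>jac c d i a\<close> is the partial derivative of the \<open>a\<close>-th coordinate of \<open>d\<close> with respect to the
  \<open>i\<close>-th coordinate of \<open>c\<close>.
\<close>

type_synonym 'm comp2 = "real^'m \<Rightarrow> 'm \<Rightarrow> 'm \<Rightarrow> real"
type_synonym 'm comp3 = "real^'m \<Rightarrow> 'm \<Rightarrow> 'm \<Rightarrow> 'm \<Rightarrow> real"

definition jac :: "('a, 'm::finite) chart \<Rightarrow> ('a, 'm) chart \<Rightarrow> 'm \<Rightarrow> 'm \<Rightarrow> real^'m \<Rightarrow> real" where
  "jac c d i a = pd i (\<lambda>x. transition c d x $ a)"

definition covariant2_field :: "('a, 'm::finite) chart set \<Rightarrow> (('a, 'm) chart \<Rightarrow> 'm comp2) \<Rightarrow> bool" where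
  "covariant2_field A T \<longleftrightarrow>
     (\<forall>c\<in>A. \<forall>i j. smooth_on (img_of c) (\<lambda>x. T c x i j)) \<and>
     (\<forall>c\<in>A. \<forall>d\<in>A. \<forall>p \<in> dom_of c \<inter> dom_of d. \<forall>i j.
        T c (coords c p) i j =
        (\<^bold>\<Sum>a b. jac c d i a (coords c p) * jac c d j b (coords c p) * T d (coords d p) a b))"

definition endomorphism_field :: "('a, 'm::finite) chart set \<Rightarrow> (('a, 'm) chart \<Rightarrow> 'm comp2) \<Rightarrow> bool" where
  "endomorphism_field A T \<longleftrightarrow>
     (\<forall>c\<in>A. \<forall>i j. smooth_on (img_of c) (\<lambda>x. T c x i j)) \<and>
     (\<forall>c\<in>A. \<forall>d\<in>A. \<forall>p \<in> dom_of c \<inter> dom_of d. \<forall>i b.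
        (\<^bold>\<Sum>k. T c (coords c p) i k * jac c d k b (coords c p)) =
        (\<^bold>\<Sum>a. jac c d i a (coords c p) * T d (coords d p) a b))"

text \<open>
  An affine connection is given by its Christoffel symbols, with the convention
  \<open>\<nabla>\<^sub>i X\<^sup>k = \<partial>\<^sub>i X\<^sup>k + \<Gamma>\<^sub>i\<^sub>p\<^sup>k X\<^sup>p\<close>, where \<open>\<Gamma>\<^sub>i\<^sub>j\<^sup>k\<close> is \<open>G x i j k\<close>.
\<close>

definition affine_connection :: "('a, 'm::finite) chart set \<Rightarrow> (('a, 'm) chart \<Rightarrow> 'm comp3) \<Rightarrow> bool" where
  "affine_connection A \<Gamma> \<longleftrightarrow>
     (\<forall>c\<in>A. \<forall>i j k. smooth_on (img_of c) (\<lambda>x. \<Gamma> c x i j k)) \<and>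
     (\<forall>c\<in>A. \<forall>d\<in>A. \<forall>p \<in> dom_of c \<inter> dom_of d. \<forall>i j e.
        (\<^bold>\<Sum>k. \<Gamma> c (coords c p) i j k * jac c d k e (coords c p)) =
        pd i (jac c d j e) (coords c p) +
        (\<^bold>\<Sum>a b. jac c d i a (coords c p) * jac c d j b (coords c p) * \<Gamma> d (coords d p) a b e))"

definition torsion_free :: "('a, 'm::finite) chart set \<Rightarrow> (('a, 'm) chart \<Rightarrow> 'm comp3) \<Rightarrow> bool" where
  "torsion_free A \<Gamma> \<longleftrightarrow> (\<forall>c\<in>A. \<forall>x\<in>img_of c. \<forall>i j k. \<Gamma> c x i j k = \<Gamma> c x j i k)"


section \<open>Covariant differentiation and curvature in a chart\<close>

text \<open>
  In the following definitions the new, differentiated index comes first. The suffix gives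
  the type of the differentiated tensor: a vector \<open>X\<^sup>k\<close>, a mixed tensor \<open>T\<^sub>j\<^sup>k\<close>, or a
  covariant tensor with one, two or three indices.
\<close>

definition cov_vec :: "'m::finite comp3 \<Rightarrow> (real^'m \<Rightarrow> 'm \<Rightarrow> real) \<Rightarrow> 'm comp2" where
  "cov_vec G X x i k = pd i (\<lambda>y. X y k) x + (\<^bold>\<Sum>p. G x i p k * X x p)"

definition cov_mix :: "'m::finite comp3 \<Rightarrow> 'm comp2 \<Rightarrow> 'm comp3" where
  "cov_mix G T x i j k =
     pd i (\<lambda>y. T y j k) x - (\<^bold>\<Sum>p. G x i j p * T x p k) + (\<^bold>\<Sum>p. G x i p k * T x j p)"

definition cov_1 :: "'m::finite comp3 \<Rightarrow> (real^'m \<Rightarrow> 'm \<Rightarrow> real) \<Rightarrow> 'm comp2" where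
  "cov_1 G T x i j = pd i (\<lambda>y. T y j) x - (\<^bold>\<Sum>p. G x i j p * T x p)"

definition cov_2 :: "'m::finite comp3 \<Rightarrow> 'm comp2 \<Rightarrow> 'm comp3" where
  "cov_2 G T x i j k =
     pd i (\<lambda>y. T y j k) x - (\<^bold>\<Sum>p. G x i j p * T x p k) - (\<^bold>\<Sum>p. G x i k p * T x j p)"

definition cov_3 ::
  "'m::finite comp3 \<Rightarrow> 'm comp3 \<Rightarrow> real^'m \<Rightarrow> 'm \<Rightarrow> 'm \<Rightarrow> 'm \<Rightarrow> 'm \<Rightarrow> real" where
  "cov_3 G T x i j k l =
     pd i (\<lambda>y. T y j k l) x - (\<^bold>\<Sum>p. G x i j p * T x p k l)
       - (\<^bold>\<Sum>p. G x i k p * T x j p l) - (\<^bold>\<Sum>p. G x i l p * T x j k p)"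

definition second_cov_vec ::
  "'m::finite comp3 \<Rightarrow> (real^'m \<Rightarrow> 'm \<Rightarrow> real) \<Rightarrow> 'm comp3" where
  "second_cov_vec G X = cov_mix G (cov_vec G X)"

definition coord_field :: "'m \<Rightarrow> real^'m \<Rightarrow> 'm \<Rightarrow> real" where
  "coord_field p x k = (if k = p then 1 else 0)"

text \<open>
  The curvature \<open>R\<^sub>i\<^sub>j\<^sub>p\<^sup>k\<close> of a torsion-free connection is defined by
  \<open>\<nabla>\<^sub>i\<nabla>\<^sub>jX\<^sup>k - \<nabla>\<^sub>j\<nabla>\<^sub>iX\<^sup>k = R\<^sub>i\<^sub>j\<^sub>p\<^sup>k X\<^sup>p\<close> for all vector fields \<open>X\<close>. Its components are
  obtained by inserting the \<open>p\<close>-th coordinate vector field; theorem \<open>ricci_identity\<close> below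
  shows that the identity then holds for all smooth \<open>X\<close>.
\<close>

definition riem :: "'m::finite comp3 \<Rightarrow> real^'m \<Rightarrow> 'm \<Rightarrow> 'm \<Rightarrow> 'm \<Rightarrow> 'm \<Rightarrow> real" where
  "riem G x i j p k =
     second_cov_vec G (coord_field p) x i j k - second_cov_vec G (coord_field p) x j i k"

definition ric :: "'m::finite comp3 \<Rightarrow> 'm comp2" where
  "ric G x i j = (\<^bold>\<Sum>p. riem G x p i j p)"


subsection \<open>The Ricci identity\<close>

lemma pd_has_derivative: "(f has_derivative f') (at x) \<Longrightarrow> pd i f x = f' (axis i 1)"
  unfolding pd_def by (metis frechet_derivative_at)

lemma pd_const: "pd i (\<lambda>x. c) x = 0"
  by (simp add: pd_def)

lemma pd_add:
  assumes "f differentiable (at x)" "g differentiable (at x)"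
  shows "pd i (\<lambda>x. f x + g x) x = pd i f x + pd i g x"
proof -
  have "((\<lambda>x. f x + g x) has_derivative
      (\<lambda>h. frechet_derivative f (at x) h + frechet_derivative g (at x) h)) (at x)"
    using assms by (intro has_derivative_add) (simp_all add: frechet_derivative_works)
  from pd_has_derivative[OF this] show ?thesis by (simp add: pd_def)
qed

lemma pd_mult:
  assumes "f differentiable (at x)" "g differentiable (at x)"
  shows "pd i (\<lambda>x. f x * g x) x = pd i f x * g x + f x * pd i g x"
proof -
  have "((\<lambda>x. f x * g x) has_derivative
      (\<lambda>h. f x * frechet_derivative g (at x) h + frechet_derivative f (at x) h * g x)) (at x)"
    using assms by (intro has_derivative_mult) (simp_all add: frechet_derivative_works)
  from pd_has_derivative[OF this] show ?thesis by (simp add: pd_def)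
qed

lemma pd_sum:
  assumes "\<And>a. a \<in> I \<Longrightarrow> f a differentiable (at x)"
  shows "pd i (\<lambda>x. \<Sum>a\<in>I. f a x) x = (\<Sum>a\<in>I. pd i (f a) x)"
proof -
  have "((\<lambda>x. \<Sum>a\<in>I. f a x) has_derivative (\<lambda>h. \<Sum>a\<in>I. frechet_derivative (f a) (at x) h)) (at x)"
    using assms by (intro has_derivative_sum) (simp add: frechet_derivative_works)
  from pd_has_derivative[OF this] show ?thesis by (simp add: pd_def)
qed

lemma pd_along_line:
  assumes "f differentiable (at (a + s *\<^sub>R axis i 1))"
  shows "((\<lambda>s. f (a + s *\<^sub>R axis i 1)) has_real_derivative pd i f (a + s *\<^sub>R axis i 1)) (at s)"
proof -
  let ?x = "a + s *\<^sub>R axis i 1"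
  have "(f has_derivative frechet_derivative f (at ?x)) (at ?x)"
    using assms by (simp add: frechet_derivative_works)
  moreover have "((\<lambda>s. a + s *\<^sub>R axis i 1) has_derivative (\<lambda>h. h *\<^sub>R axis i 1)) (at s)"
    by (auto intro!: derivative_eq_intros)
  ultimately have "((\<lambda>s. f (a + s *\<^sub>R axis i 1)) has_derivative
      (\<lambda>h. frechet_derivative f (at ?x) (h *\<^sub>R axis i 1))) (at s)"
    by (rule has_derivative_compose[rotated])
  moreover have "linear (frechet_derivative f (at ?x))"
    using assms by (rule linear_frechet_derivative)
  ultimately show ?thesis
    by (simp add: has_field_derivative_def pd_def linear_scale mult.commute[of _ "frechet_derivative f _ _"])
qed

lemma second_difference:
  fixes f :: "real^'m::finite \<Rightarrow> real"
  assumes h: "h > 0"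
    and sq: "\<And>s t. 0 \<le> s \<Longrightarrow> s \<le> h \<Longrightarrow> 0 \<le> t \<Longrightarrow> t \<le> h \<Longrightarrow>
               x + s *\<^sub>R axis i 1 + t *\<^sub>R axis j 1 \<in> S"
    and f: "\<And>y. y \<in> S \<Longrightarrow> f differentiable (at y)"
    and f': "\<And>y. y \<in> S \<Longrightarrow> pd i f differentiable (at y)"
  shows "\<exists>s t. 0 < s \<and> s < h \<and> 0 < t \<and> t < h \<and>
    f (x + h *\<^sub>R axis i 1 + h *\<^sub>R axis j 1) - f (x + h *\<^sub>R axis i 1)
      - f (x + h *\<^sub>R axis j 1) + f x
    = h * h * pd j (pd i f) (x + s *\<^sub>R axis i 1 + t *\<^sub>R axis j 1)"
proof -
  let ?ei = "axis i 1 :: real^'m" and ?ej = "axis j 1 :: real^'m"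
  define u where "u s = f ((x + h *\<^sub>R ?ej) + s *\<^sub>R ?ei) - f (x + s *\<^sub>R ?ei)" for s
  have du: "(u has_real_derivative
      pd i f ((x + h *\<^sub>R ?ej) + s *\<^sub>R ?ei) - pd i f (x + s *\<^sub>R ?ei)) (at s)"
    if "0 \<le> s" "s \<le> h" for s
  proof -
    have 1: "x + s *\<^sub>R ?ei \<in> S" using sq[OF that, of 0] h by simp
    have "x + s *\<^sub>R ?ei + h *\<^sub>R ?ej \<in> S" using sq[OF that, of h] h by simp
    then have 2: "(x + h *\<^sub>R ?ej) + s *\<^sub>R ?ei \<in> S" by (simp only: ac_simps)
    show ?thesis unfolding u_def
      by (rule DERIV_diff[OF pd_along_line[OF f[OF 2]] pd_along_line[OF f[OF 1]]])
  qed
  obtain s where s: "0 < s" "s < h"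
    "u h - u 0 = (h - 0) * (pd i f ((x + h *\<^sub>R ?ej) + s *\<^sub>R ?ei) - pd i f (x + s *\<^sub>R ?ei))"
    using MVT2[OF h du] by auto
  define v where "v t = pd i f ((x + s *\<^sub>R ?ei) + t *\<^sub>R ?ej)" for t
  have dv: "(v has_real_derivative pd j (pd i f) ((x + s *\<^sub>R ?ei) + t *\<^sub>R ?ej)) (at t)"
    if "0 \<le> t" "t \<le> h" for t
    unfolding v_def by (rule pd_along_line[OF f'[OF sq]]) (use s that in auto)
  obtain t where t: "0 < t" "t < h"
    "v h - v 0 = (h - 0) * pd j (pd i f) ((x + s *\<^sub>R ?ei) + t *\<^sub>R ?ej)"
    using MVT2[OF h dv] by auto
  have "u h - u 0 = h * (v h - v 0)"
    using s(3) by (simp add: v_def ac_simps)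
  then have "u h - u 0 = h * h * pd j (pd i f) (x + s *\<^sub>R ?ei + t *\<^sub>R ?ej)"
    using t(3) by simp
  then show ?thesis
    using s t by (intro exI[of _ s] exI[of _ t]) (simp add: u_def ac_simps)
qed

lemma pd_commute:
  fixes f :: "real^'m::finite \<Rightarrow> real"
  assumes S: "open S" "x \<in> S" and f: "smooth_on S f"
  shows "pd i (pd j f) x = pd j (pd i f) x"
proof (rule ccontr)
  let ?ei = "axis i 1 :: real^'m" and ?ej = "axis j 1 :: real^'m"
  assume ne: "pd i (pd j f) x \<noteq> pd j (pd i f) x"
  have ck: "Ck_on (Suc (Suc 0)) S f" using f unfolding smooth_on_def by blast
  define w where "w y = pd i (pd j f) y" for y
  define z where "z y = pd j (pd i f) y" for y
  define e where "e = \<bar>w x - z x\<bar> / 2"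
  have e: "e > 0" using ne by (simp add: e_def w_def z_def)
  have "isCont w x" "isCont z x"
    using ck S unfolding w_def z_def by (simp_all add: continuous_on_eq_continuous_at)
  then obtain d1 d2 where d: "d1 > 0" "\<And>y. dist y x < d1 \<Longrightarrow> dist (w y) (w x) < e"
      "d2 > 0" "\<And>y. dist y x < d2 \<Longrightarrow> dist (z y) (z x) < e"
    using e unfolding continuous_at_eps_delta dist_norm by (metis real_norm_def)
  obtain d3 where d3: "d3 > 0" "\<And>y. dist y x < d3 \<Longrightarrow> y \<in> S"
    using S open_dist by blast
  define h where "h = min d1 (min d2 d3) / 3"
  have h: "h > 0" "2 * h < d1" "2 * h < d2" "2 * h < d3"
    using d d3 by (auto simp: h_def min_def)
  have near: "dist (x + s *\<^sub>R axis p 1 + t *\<^sub>R axis q 1) x \<le> 2 * h"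
    if "0 \<le> s" "s \<le> h" "0 \<le> t" "t \<le> h" for s t and p q :: 'm
  proof -
    have "norm (s *\<^sub>R axis p 1 + t *\<^sub>R axis q 1 :: real^'m) \<le> s + t"
      using norm_triangle_ineq[of "s *\<^sub>R axis p 1 :: real^'m" "t *\<^sub>R axis q 1"] that by simp
    then show ?thesis using that by (simp add: dist_norm add.assoc)
  qed
  have inS: "x + s *\<^sub>R axis p 1 + t *\<^sub>R axis q 1 \<in> S"
    if "0 \<le> s" "s \<le> h" "0 \<le> t" "t \<le> h" for s t and p q :: 'm
    using near[OF that, of p q] h by (intro d3(2)) linarith
  have f1: "f differentiable (at y)" and f2: "pd k f differentiable (at y)" if "y \<in> S" for y k
    using ck that by auto
  obtain s t where st: "0 < s" "s < h" "0 < t" "t < h"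
    "f (x + h *\<^sub>R ?ei + h *\<^sub>R ?ej) - f (x + h *\<^sub>R ?ei) - f (x + h *\<^sub>R ?ej) + f x
      = h * h * z (x + s *\<^sub>R ?ei + t *\<^sub>R ?ej)"
    using second_difference[OF h(1) inS f1 f2, of i j] unfolding z_def by auto
  obtain s' t' where st': "0 < s'" "s' < h" "0 < t'" "t' < h"
    "f (x + h *\<^sub>R ?ej + h *\<^sub>R ?ei) - f (x + h *\<^sub>R ?ej) - f (x + h *\<^sub>R ?ei) + f x
      = h * h * w (x + s' *\<^sub>R ?ej + t' *\<^sub>R ?ei)"
    using second_difference[OF h(1) inS f1 f2, of j i] unfolding w_def by auto
  have "f (x + h *\<^sub>R ?ej + h *\<^sub>R ?ei) = f (x + h *\<^sub>R ?ei + h *\<^sub>R ?ej)"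
    by (simp add: algebra_simps)
  then have "h * h * w (x + s' *\<^sub>R ?ej + t' *\<^sub>R ?ei) = h * h * z (x + s *\<^sub>R ?ei + t *\<^sub>R ?ej)"
    using st(5) st'(5) by linarith
  then have "w (x + s' *\<^sub>R ?ej + t' *\<^sub>R ?ei) = z (x + s *\<^sub>R ?ei + t *\<^sub>R ?ej)"
    using h(1) by simp
  moreover have "dist (w (x + s' *\<^sub>R ?ej + t' *\<^sub>R ?ei)) (w x) < e"
    using near[of s' t' j i] st' h by (intro d(2)) linarith
  moreover have "dist (z (x + s *\<^sub>R ?ei + t *\<^sub>R ?ej)) (z x) < e"
    using near[of s t i j] st h by (intro d(4)) linarith
  ultimately show False
    by (simp add: e_def dist_real_def abs_if split: if_splits)
qed

lemma smooth_onD: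
  assumes "smooth_on S f" "x \<in> S"
  shows "f differentiable (at x)" "pd i f differentiable (at x)"
proof -
  have "Ck_on (Suc (Suc 0)) S f" using assms unfolding smooth_on_def by blast
  then show "f differentiable (at x)" "pd i f differentiable (at x)" using assms(2) by auto
qed

lemma second_cov_vec_expand:
  fixes G :: "'m::finite comp3"
  assumes G: "\<And>i j k. (\<lambda>y. G y i j k) differentiable (at x)"
    and X: "\<And>k. (\<lambda>y. X y k) differentiable (at x)"
      "\<And>j k. pd j (\<lambda>y. X y k) differentiable (at x)"
  shows "second_cov_vec G X x i j k =
    pd i (pd j (\<lambda>y. X y k)) x
    + (\<^bold>\<Sum>p. pd i (\<lambda>y. G y j p k) x * X x p + G x j p k * pd i (\<lambda>y. X y p) x)
    - (\<^bold>\<Sum>p. G x i j p * cov_vec G X x p k)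
    + (\<^bold>\<Sum>p. G x i p k * (pd j (\<lambda>y. X y p) x + (\<^bold>\<Sum>q. G x j q p * X x q)))"
proof -
  have dm: "(\<lambda>y. G y j p k * X y p) differentiable (at x)" for p
    using G X by (intro differentiable_mult)
  have ds: "(\<lambda>y. \<^bold>\<Sum>p. G y j p k * X y p) differentiable (at x)"
    using dm by (intro differentiable_sum) auto
  have e: "pd i (\<lambda>y. cov_vec G X y j k) x =
      pd i (pd j (\<lambda>y. X y k)) x
      + (\<^bold>\<Sum>p. pd i (\<lambda>y. G y j p k) x * X x p + G x j p k * pd i (\<lambda>y. X y p) x)"
    unfolding cov_vec_def using dm ds G X by (simp add: pd_add pd_sum pd_mult)
  show ?thesis
    unfolding second_cov_vec_def cov_mix_def e by (simp only: cov_vec_def[of G X x j])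
qed

lemma riem_expand:
  fixes G :: "'m::finite comp3"
  assumes "\<And>i j k. (\<lambda>y. G y i j k) differentiable (at x)"
    and "\<And>i j k. G x i j k = G x j i k"
  shows "riem G x i j p k =
    pd i (\<lambda>y. G y j p k) x - pd j (\<lambda>y. G y i p k) x
    + (\<^bold>\<Sum>q. G x i q k * G x j p q) - (\<^bold>\<Sum>q. G x j q k * G x i p q)"
proof -
  have c: "pd j (\<lambda>y. coord_field p y k) = (\<lambda>y. 0)" for j k :: 'm
    by (simp add: fun_eq_iff coord_field_def pd_const)
  have d: "(\<lambda>y. coord_field p y k) differentiable (at x)"
    "pd j (\<lambda>y. coord_field p y k) differentiable (at x)" for j k :: 'm
    unfolding c by (simp_all add: coord_field_def)
  have cf: "(\<^bold>\<Sum>q. f q * coord_field p x q) = f p" for f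
    by (simp add: coord_field_def if_distrib[of "(*) _"] cong: if_cong)
  have e: "second_cov_vec G (coord_field p) x i j k =
      pd i (\<lambda>y. G y j p k) x - (\<^bold>\<Sum>q. G x i j q * cov_vec G (coord_field p) x q k)
      + (\<^bold>\<Sum>q. G x i q k * G x j p q)" for i j
    unfolding second_cov_vec_expand[OF assms(1) d] c pd_const
    by (simp add: cf)
  show ?thesis
    unfolding riem_def e by (simp add: assms(2)[of j i])
qed

theorem ricci_identity:
  fixes G :: "'m::finite comp3"
  assumes S: "open S" "x \<in> S"
    and G: "\<And>i j k. smooth_on S (\<lambda>y. G y i j k)" "\<And>i j k. G x i j k = G x j i k"
    and X: "\<And>k. smooth_on S (\<lambda>y. X y k)"
  shows "second_cov_vec G X x i j k - second_cov_vec G X x j i k = (\<^bold>\<Sum>p. riem G x i j p k * X x p)"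
proof -
  have dG: "(\<lambda>y. G y i j k) differentiable (at x)" for i j k
    using smooth_onD G(1) S(2) by blast
  have dX: "(\<lambda>y. X y k) differentiable (at x)" "pd j (\<lambda>y. X y k) differentiable (at x)" for j k
    using smooth_onD X S(2) by blast+
  have swap: "(\<^bold>\<Sum>q. G x i q k * (\<^bold>\<Sum>p. G x j p q * X x p)) = (\<^bold>\<Sum>p. (\<^bold>\<Sum>q. G x i q k * G x j p q) * X x p)" for i j
    unfolding sum_distrib_left sum_distrib_right mult.assoc by (rule sum.swap)
  have "pd i (pd j (\<lambda>y. X y k)) x = pd j (pd i (\<lambda>y. X y k)) x"
    using S X by (rule pd_commute)
  moreover have "(\<^bold>\<Sum>p. G x j i p * cov_vec G X x p k) = (\<^bold>\<Sum>p. G x i j p * cov_vec G X x p k)"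
    by (rule sum.cong) (simp_all only: G(2)[of j i])
  moreover have "(\<^bold>\<Sum>p. riem G x i j p k * X x p) =
      (\<^bold>\<Sum>p. pd i (\<lambda>y. G y j p k) x * X x p) - (\<^bold>\<Sum>p. pd j (\<lambda>y. G y i p k) x * X x p)
      + (\<^bold>\<Sum>p. (\<^bold>\<Sum>q. G x i q k * G x j p q) * X x p)
      - (\<^bold>\<Sum>p. (\<^bold>\<Sum>q. G x j q k * G x i p q) * X x p)"
    unfolding riem_expand[OF dG G(2)] by (simp only: left_diff_distrib distrib_right sum.distrib sum_subtractf)
  ultimately show ?thesis
    unfolding second_cov_vec_expand[OF dG dX] distrib_left sum.distrib swap by linarith
qed


section \<open>Symplectic and Kaehler structures\<close>

definition symplectic_form :: "('a, 'm::finite) chart set \<Rightarrow> (('a, 'm) chart \<Rightarrow> 'm comp2) \<Rightarrow> bool" where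
  "symplectic_form A \<Omega> \<longleftrightarrow>
     covariant2_field A \<Omega> \<and>
     (\<forall>c\<in>A. \<forall>x\<in>img_of c.
        (\<forall>i j. \<Omega> c x i j = - \<Omega> c x j i) \<and>
        (\<forall>X. (\<forall>j. (\<^bold>\<Sum>i. X i * \<Omega> c x i j) = 0) \<longrightarrow> (\<forall>i. X i = 0)) \<and>
        (\<forall>i j k. pd i (\<lambda>y. \<Omega> c y j k) x + pd j (\<lambda>y. \<Omega> c y k i) x + pd k (\<lambda>y. \<Omega> c y i j) x = 0))"

definition lie_bracket ::
  "(real^'m \<Rightarrow> 'm::finite \<Rightarrow> real) \<Rightarrow> (real^'m \<Rightarrow> 'm \<Rightarrow> real) \<Rightarrow> real^'m \<Rightarrow> 'm \<Rightarrow> real" where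
  "lie_bracket X Y x k = (\<^bold>\<Sum>p. X x p * pd p (\<lambda>y. Y y k) x - Y x p * pd p (\<lambda>y. X y k) x)"

definition apply_endo ::
  "'m::finite comp2 \<Rightarrow> (real^'m \<Rightarrow> 'm \<Rightarrow> real) \<Rightarrow> real^'m \<Rightarrow> 'm \<Rightarrow> real" where
  "apply_endo J X x k = (\<^bold>\<Sum>p. X x p * J x p k)"

text \<open>
  The Nijenhuis tensor \<open>N(X, Y) = [JX, JY] - J[JX, Y] - J[X, JY] - [X, Y]\<close>, evaluated on
  coordinate vector fields.
\<close>

definition nijenhuis :: "'m::finite comp2 \<Rightarrow> 'm comp3" where
  "nijenhuis J x i j k =
     (let X = coord_field i; Y = coord_field j; JX = apply_endo J X; JY = apply_endo J Y
      in lie_bracket JX JY x k - apply_endo J (lie_bracket JX Y) x k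
         - apply_endo J (lie_bracket X JY) x k - lie_bracket X Y x k)"

definition integrable_complex_structure ::
  "('a, 'm::finite) chart set \<Rightarrow> (('a, 'm) chart \<Rightarrow> 'm comp2) \<Rightarrow> bool" where
  "integrable_complex_structure A J \<longleftrightarrow>
     endomorphism_field A J \<and>
     (\<forall>c\<in>A. \<forall>x\<in>img_of c.
        (\<forall>i j. (\<^bold>\<Sum>p. J c x i p * J c x p j) = (if i = j then - 1 else 0)) \<and>
        (\<forall>i j k. nijenhuis (J c) x i j k = 0))"

definition kaehler_structure ::
  "('a, 'm::finite) chart set \<Rightarrow> (('a, 'm) chart \<Rightarrow> 'm comp2) \<Rightarrow> (('a, 'm) chart \<Rightarrow> 'm comp2) \<Rightarrow>
   (('a, 'm) chart \<Rightarrow> 'm comp2) \<Rightarrow> bool" where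
  "kaehler_structure A g J \<Omega> \<longleftrightarrow>
     symplectic_form A \<Omega> \<and> integrable_complex_structure A J \<and>
     (\<forall>c\<in>A. \<forall>x\<in>img_of c.
        (\<forall>i j. g c x i j = - (\<^bold>\<Sum>p. J c x i p * \<Omega> c x p j)) \<and>
        (\<forall>i j. g c x i j = g c x j i) \<and>
        (\<forall>X. (\<exists>i. X i \<noteq> 0) \<longrightarrow> (\<^bold>\<Sum>i j. X i * X j * g c x i j) > 0))"

definition levi_civita ::
  "('a, 'm::finite) chart set \<Rightarrow> (('a, 'm) chart \<Rightarrow> 'm comp2) \<Rightarrow> (('a, 'm) chart \<Rightarrow> 'm comp3) \<Rightarrow> bool" where
  "levi_civita A g \<Gamma> \<longleftrightarrow>
     affine_connection A \<Gamma> \<and> torsion_free A \<Gamma> \<and>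
     (\<forall>c\<in>A. \<forall>x\<in>img_of c. \<forall>i j k. cov_2 (\<Gamma> c) (g c) x i j k = 0)"


section \<open>The function \<open>\<K>(\<nabla>)\<close>\<close>

text \<open>The sign in \<open>\<Omega>\<^sup>i\<^sup>p \<Omega>\<^sub>p\<^sub>j = - \<delta>\<^sub>j\<^sup>i\<close> makes \<open>\<Omega>\<^sup>i\<^sup>j\<close> minus the inverse matrix.\<close>

definition symp_up :: "'m::finite comp2 \<Rightarrow> 'm comp2" where
  "symp_up \<Omega> x i j = - matrix_inv (\<chi> p q. \<Omega> x p q) $ i $ j"

definition riem_symp ::
  "'m::finite comp2 \<Rightarrow> 'm comp3 \<Rightarrow> real^'m \<Rightarrow> 'm \<Rightarrow> 'm \<Rightarrow> 'm \<Rightarrow> 'm \<Rightarrow> real" where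
  "riem_symp \<Omega> G x i j k l = (\<^bold>\<Sum>p. riem G x i j k p * \<Omega> x p l)"

definition K_map :: "'m::finite comp2 \<Rightarrow> 'm comp3 \<Rightarrow> real^'m \<Rightarrow> real" where
  "K_map \<Omega> G x =
     (let U = symp_up \<Omega> x; R2 = ric G x; R4 = riem_symp \<Omega> G x in
      (\<^bold>\<Sum>i j p q. U i p * U j q * cov_3 G (cov_2 G (ric G)) x p q i j)
      - 1/2 * (\<^bold>\<Sum>i j p q. U i p * U j q * R2 p q * R2 i j)
      + 1/4 * (\<^bold>\<Sum>i j k l p q r s.
                 U i p * U j q * U k r * U l s * R4 p q r s * R4 i j k l))"


section \<open>Riemannian quantities\<close>

definition metric_up :: "'m::finite comp2 \<Rightarrow> 'm comp2" where
  "metric_up g x i j = matrix_inv (\<chi> p q. g x p q) $ i $ j"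

definition scal :: "'m::finite comp2 \<Rightarrow> 'm comp3 \<Rightarrow> real^'m \<Rightarrow> real" where
  "scal g G x = (\<^bold>\<Sum>i j. metric_up g x i j * ric G x i j)"

definition laplacian :: "'m::finite comp2 \<Rightarrow> 'm comp3 \<Rightarrow> (real^'m \<Rightarrow> real) \<Rightarrow> real^'m \<Rightarrow> real" where
  "laplacian g G f x = (\<^bold>\<Sum>i j. metric_up g x i j * cov_1 G (\<lambda>y k. pd k f y) x i j)"

definition conformal_laplacian ::
  "nat \<Rightarrow> 'm::finite comp2 \<Rightarrow> 'm comp3 \<Rightarrow> (real^'m \<Rightarrow> real) \<Rightarrow> real^'m \<Rightarrow> real" where
  "conformal_laplacian n g G f x =
     laplacian g G f x - (real n - 1) / (2 * (2 * real n - 1)) * scal g G x * f x"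

definition tracefree_ric :: "nat \<Rightarrow> 'm::finite comp2 \<Rightarrow> 'm comp3 \<Rightarrow> 'm comp2" where
  "tracefree_ric n g G x i j = ric G x i j - 1 / (2 * real n) * scal g G x * g x i j"

definition weyl ::
  "nat \<Rightarrow> 'm::finite comp2 \<Rightarrow> 'm comp3 \<Rightarrow> real^'m \<Rightarrow> 'm \<Rightarrow> 'm \<Rightarrow> 'm \<Rightarrow> 'm \<Rightarrow> real" where
  "weyl n g G x i j k l =
     (let h = g x; R2 = ric G x in
      (\<^bold>\<Sum>p. riem G x i j k p * h p l)
      + 1 / (real n - 1) *
          (1/2 * (h k i * R2 j l - h k j * R2 i l) - 1/2 * (h l i * R2 j k - h l j * R2 i k))
      - 1 / ((real n - 1) * (2 * real n - 1)) * scal g G x *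
          (1/2 * (h k i * h j l - h k j * h i l)))"

definition norm_sq2 :: "'m::finite comp2 \<Rightarrow> 'm comp2 \<Rightarrow> real^'m \<Rightarrow> real" where
  "norm_sq2 g T x =
     (let u = metric_up g x in \<^bold>\<Sum>i j p q. u i p * u j q * T x i j * T x p q)"

definition norm_sq4 ::
  "'m::finite comp2 \<Rightarrow> (real^'m \<Rightarrow> 'm \<Rightarrow> 'm \<Rightarrow> 'm \<Rightarrow> 'm \<Rightarrow> real) \<Rightarrow> real^'m \<Rightarrow> real" where
  "norm_sq4 g T x =
     (let u = metric_up g x in \<^bold>\<Sum>i j k l p q r s.
        u i p * u j q * u k r * u l s * T x i j k l * T x p q r s)"

text \<open>The same for a tensor \<open>T\<^sub>i\<^sub>j\<^sub>k\<^sup>l\<close> with three lower indices and one upper index.\<close>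

definition norm_sq31 ::
  "'m::finite comp2 \<Rightarrow> (real^'m \<Rightarrow> 'm \<Rightarrow> 'm \<Rightarrow> 'm \<Rightarrow> 'm \<Rightarrow> real) \<Rightarrow> real^'m \<Rightarrow> real" where
  "norm_sq31 g T x =
     (let u = metric_up g x in \<^bold>\<Sum>i j k l p q r s.
        u i p * u j q * u k r * g x l s * T x i j k l * T x p q r s)"

end

theory Submission
  imports Defs
begin

text \<open>
  Since \<open>\<nabla>g = \<nabla>J = \<nabla>\<Omega> = 0\<close>, the inverses are related by \<open>\<Omega>\<^sup>i\<^sup>j = g\<^sup>i\<^sup>p J\<^sub>p\<^sup>j\<close>, and both the curvature (in its first
  two indices) and the Ricci tensor are \<open>J\<close>-invariant. Raising a pair of \<open>J\<close>-invariant indices with \<open>\<Omega>\<close>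
  is therefore the same as raising it with \<open>g\<close>, which turns the two quadratic terms of \<open>\<K>\<close> into
  \<open>|Ric|\<^sup>2\<close> and \<open>|Riem|\<^sup>2\<close>; the derivative term becomes half the Laplacian of the scalar curvature by
  the contracted second Bianchi identity. The other two formulas come from writing the Weyl tensor
  as the lowered curvature plus a Kulkarni-Nomizu product of \<open>g\<close> with a Schouten tensor: being
  trace-free, the Weyl tensor is orthogonal to every such product.
\<close>

section \<open>Smooth functions\<close>

text \<open>Integrability of \<open>J\<close> and closedness of \<open>\<Omega>\<close> are
  conditions on partial derivatives of components, while every later step uses that both tensors are
  parallel. That passage has to be proved, and it rests on vanishing torsion and on
  \<open>\<nabla>g = 0\<close>. For fixed values of the remaining indices a tensor is treated as a
  matrix: contraction becomes a matrix product, and J-invariance becomes a commutation rule between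
  matrices. The derivative term of \<open>\<K>\<close> resists the argument used for the quadratic
  terms, because each \<open>\<Omega>\<close> there joins a derivative index to a Ricci index, and
  such a pair has no evident invariance. Instead, the inner contraction yields
  \<open>1/2 * J\<close> applied to the differential of the scalar curvature, and the outer
  contraction supplies the second \<open>J\<close> that removes the first. For the Weyl tensor,
  orthogonality avoids squaring the correction: its norm is its product with the curvature alone, so
  one contraction of the curvature with the Schouten tensor remains to be computed.\<close>

lemma pd_cong:
  assumes "open S" "x \<in> S" "\<And>y. y \<in> S \<Longrightarrow> f y = g y"
  shows "pd i f x = pd i g x"
proof -
  \<comment> \<open>\<open>frechet_derivative\<close> is a choice from the predicate
    \<open>has_derivative\<close>, so it is enough that \<open>f\<close> and \<open>g\<close>
    satisfy this predicate for the same \<open>D\<close>. No differentiability is required.\<close>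
  have "(f has_derivative D) (at x) \<longleftrightarrow> (g has_derivative D) (at x)" for D
    using has_derivative_transform_within_open[OF _ assms(1,2), of f D UNIV g]
      has_derivative_transform_within_open[OF _ assms(1,2), of g D UNIV f] assms(3) by auto
  then show ?thesis by (simp add: pd_def frechet_derivative_def)
qed

lemma differentiable_cong_open:
  assumes "open S" "x \<in> S" "\<And>y. y \<in> S \<Longrightarrow> f y = g y" "f differentiable (at x)"
  shows "g differentiable (at x)"
proof -
  obtain D where "(f has_derivative D) (at x)" using assms(4) by (auto simp: differentiable_def)
  from has_derivative_transform_within_open[OF this assms(1,2,3)] show ?thesis
    by (auto simp: differentiable_def)
qed

lemma Ck_on_cong:
  assumes "open S" "\<And>y. y \<in> S \<Longrightarrow> f y = g y" "Ck_on k S f"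
  shows "Ck_on k S g"
  using assms(2,3)
proof (induction k arbitrary: f g)
  case 0
  then show ?case using continuous_on_cong[of S S f g] by simp
next
  case (Suc k)
  have "Ck_on k S (pd i g)" for i
    using Suc.IH[of "pd i f" "pd i g"] pd_cong[OF assms(1) _ Suc.prems(1)] Suc.prems(2) by simp
  then show ?case
    using differentiable_cong_open[OF assms(1) _ Suc.prems(1)] Suc.prems(2) by auto
qed

lemma Ck_on_mono: "Ck_on (Suc k) S f \<Longrightarrow> Ck_on k S f"
proof (induction k arbitrary: f)
  case 0
  then show ?case
    by (auto intro!: differentiable_imp_continuous_on differentiable_at_imp_differentiable_on)
qed auto

lemma Ck_on_const: "Ck_on k S (\<lambda>x. c)"
proof (induction k arbitrary: c)
  case (Suc k)
  have "pd i (\<lambda>x. c) = (\<lambda>x. 0)" for i :: 'a by (simp add: fun_eq_iff pd_const)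
  then show ?case using Suc by simp
qed simp

lemma Ck_on_add:
  assumes "open S" "Ck_on k S f" "Ck_on k S g"
  shows "Ck_on k S (\<lambda>x. f x + g x)"
  using assms(2,3)
proof (induction k arbitrary: f g)
  case 0
  then show ?case by (simp add: continuous_on_add)
next
  case (Suc k)
  have "Ck_on k S (pd i (\<lambda>x. f x + g x))" for i
    by (rule Ck_on_cong[OF assms(1), of "\<lambda>x. pd i f x + pd i g x"])
      (use Suc in \<open>auto simp: pd_add\<close>)
  then show ?case using Suc.prems by simp
qed

lemma Ck_on_mult:
  assumes "open S" "Ck_on k S f" "Ck_on k S g"
  shows "Ck_on k S (\<lambda>x. f x * g x)"
  using assms(2,3)
proof (induction k arbitrary: f g)
  case 0
  then show ?case by (simp add: continuous_on_mult)
next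
  case (Suc k)
  have "Ck_on k S f" "Ck_on k S g" using Suc.prems by (blast intro: Ck_on_mono)+
  then have "Ck_on k S (\<lambda>x. pd i f x * g x + f x * pd i g x)" for i
    using Suc.prems by (intro Ck_on_add Suc.IH assms(1)) auto
  then have "Ck_on k S (pd i (\<lambda>x. f x * g x))" for i
    by (rule Ck_on_cong[OF assms(1), rotated]) (use Suc.prems in \<open>auto simp: pd_mult\<close>)
  then show ?case using Suc.prems by simp
qed

lemma pd_inverse:
  assumes "f differentiable (at x)" "f x \<noteq> 0"
  shows "pd i (\<lambda>x. inverse (f x)) x = - (pd i f x * (inverse (f x) * inverse (f x)))"
proof -
  have "((\<lambda>x. inverse (f x)) has_derivative
      (\<lambda>h. - (inverse (f x) * frechet_derivative f (at x) h * inverse (f x)))) (at x)"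
    using assms by (intro Deriv.has_derivative_inverse) (simp_all add: frechet_derivative_works)
  from pd_has_derivative[OF this] show ?thesis by (simp add: pd_def ac_simps)
qed

lemma Ck_on_inverse:
  assumes "open S" "\<And>x. x \<in> S \<Longrightarrow> f x \<noteq> 0" "Ck_on k S f"
  shows "Ck_on k S (\<lambda>x. inverse (f x))"
  using assms(3)
proof (induction k)
  case 0
  then show ?case using assms(2) by (simp add: continuous_on_inverse)
next
  case (Suc k)
  have "Ck_on k S (\<lambda>x. inverse (f x))" using Suc Ck_on_mono by blast
  then have "Ck_on k S (\<lambda>x. -1 * (pd i f x * (inverse (f x) * inverse (f x))))" for i
    using Suc.prems by (intro Ck_on_mult Ck_on_const assms(1)) auto
  then have "Ck_on k S (pd i (\<lambda>x. inverse (f x)))" for i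
    by (rule Ck_on_cong[OF assms(1), rotated])
      (use Suc.prems assms(2) in \<open>auto simp: pd_inverse\<close>)
  then show ?case using Suc.prems assms(2) by (auto intro!: differentiable_inverse)
qed

lemma smooth_on_const: "smooth_on S (\<lambda>x. c)"
  by (simp add: smooth_on_def Ck_on_const)

lemma smooth_on_cong:
  "open S \<Longrightarrow> smooth_on S f \<Longrightarrow> (\<And>y. y \<in> S \<Longrightarrow> f y = g y) \<Longrightarrow> smooth_on S g"
  unfolding smooth_on_def using Ck_on_cong by blast

lemma smooth_on_pd: "smooth_on S f \<Longrightarrow> smooth_on S (pd i f)"
  unfolding smooth_on_def by (meson Ck_on.simps(2))

lemma smooth_on_add:
  "open S \<Longrightarrow> smooth_on S f \<Longrightarrow> smooth_on S g \<Longrightarrow> smooth_on S (\<lambda>x. f x + g x)"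
  by (simp add: smooth_on_def Ck_on_add)

lemma smooth_on_mult:
  "open S \<Longrightarrow> smooth_on S f \<Longrightarrow> smooth_on S g \<Longrightarrow> smooth_on S (\<lambda>x. f x * g x)"
  by (simp add: smooth_on_def Ck_on_mult)

lemma smooth_on_inverse:
  "open S \<Longrightarrow> smooth_on S f \<Longrightarrow> (\<And>x. x \<in> S \<Longrightarrow> f x \<noteq> 0) \<Longrightarrow> smooth_on S (\<lambda>x. inverse (f x))"
  by (simp add: smooth_on_def Ck_on_inverse)

lemma smooth_on_minus: "open S \<Longrightarrow> smooth_on S f \<Longrightarrow> smooth_on S (\<lambda>x. - f x)"
  using smooth_on_mult[OF _ smooth_on_const, of S f "-1"] by simp

lemma smooth_on_diff:
  "open S \<Longrightarrow> smooth_on S f \<Longrightarrow> smooth_on S g \<Longrightarrow> smooth_on S (\<lambda>x. f x - g x)"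
  using smooth_on_add[OF _ _ smooth_on_minus, of S f g] by simp

lemma smooth_on_sum:
  "open S \<Longrightarrow> (\<And>a. a \<in> I \<Longrightarrow> smooth_on S (f a)) \<Longrightarrow> smooth_on S (\<lambda>x. \<Sum>a\<in>I. f a x)"
  by (induction I rule: infinite_finite_induct) (auto intro: smooth_on_const smooth_on_add)

lemma smooth_on_prod:
  "open S \<Longrightarrow> (\<And>a. a \<in> I \<Longrightarrow> smooth_on S (f a)) \<Longrightarrow> smooth_on S (\<lambda>x. \<Prod>a\<in>I. f a x)"
  by (induction I rule: infinite_finite_induct) (auto intro: smooth_on_const smooth_on_mult)

lemmas smooth_on_intros =
  smooth_on_const smooth_on_pd smooth_on_add smooth_on_mult smooth_on_minus smooth_on_diff
  smooth_on_sum smooth_on_prod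

lemma smooth_on_det:
  fixes F :: "real^'m \<Rightarrow> real^'k^'k"
  assumes "open S" "\<And>j k. smooth_on S (\<lambda>y. F y $ j $ k)"
  shows "smooth_on S (\<lambda>y. det (F y))"
  unfolding det_def by (intro smooth_on_intros assms)

lemma matrix_inv_right_left:
  fixes B :: "real^'k^'k"
  assumes "invertible B"
  shows "B ** matrix_inv B = mat 1" "matrix_inv B ** B = mat 1"
  using someI_ex[OF assms[unfolded invertible_def]] by (simp_all add: matrix_inv_def)

text \<open>By Cramer's rule the entry is a quotient of determinants, hence smooth. \<open>E\<close>
  is \<open>F\<close> with column \<open>a\<close> replaced by the unit vector
  \<open>axis b 1\<close>.\<close>

lemma smooth_on_matrix_inv:
  fixes F :: "real^'m \<Rightarrow> real^'k^'k"
  assumes S: "open S" and F: "\<And>j k. smooth_on S (\<lambda>y. F y $ j $ k)"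
    and inv: "\<And>y. y \<in> S \<Longrightarrow> invertible (F y)"
  shows "smooth_on S (\<lambda>y. matrix_inv (F y) $ a $ b)"
proof -
  have d: "det (F y) \<noteq> 0" if "y \<in> S" for y
    using inv[OF that] by (simp add: invertible_det_nz)
  define E where "E y = (\<chi> i j. if j = a then axis b 1 $ i else F y $ i $ j)" for y
  have E: "smooth_on S (\<lambda>y. E y $ i $ j)" for i j
    by (cases "j = a") (simp_all add: E_def smooth_on_const F)
  have eq: "det (E y) * inverse (det (F y)) = matrix_inv (F y) $ a $ b" if "y \<in> S" for y
  proof -
    have "F y *v (matrix_inv (F y) *v axis b 1) = axis b 1"
      by (simp add: matrix_vector_mul_assoc matrix_inv_right_left inv that)
    then have "matrix_inv (F y) *v axis b 1 =
        (\<chi> k. det (\<chi> i j. if j = k then axis b 1 $ i else F y $ i $ j) / det (F y))"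
      using cramer[OF d[OF that]] by blast
    then have "(matrix_inv (F y) *v axis b 1) $ a = det (E y) / det (F y)"
      by (simp add: E_def)
    then show ?thesis
      by (simp add: matrix_vector_mult_basis column_def divide_inverse)
  qed
  show ?thesis
    by (rule smooth_on_cong[OF S _ eq])
      (intro smooth_on_mult smooth_on_inverse smooth_on_det S E F d)
qed

section \<open>Matrix-valued functions\<close>

definition pdm :: "'m \<Rightarrow> (real^'m \<Rightarrow> real^'k^'k) \<Rightarrow> real^'m \<Rightarrow> real^'k^'k" where
  "pdm i F x = (\<chi> j k. pd i (\<lambda>y. F y $ j $ k) x)"

definition smoothm :: "(real^'m) set \<Rightarrow> (real^'m \<Rightarrow> real^'k^'k) \<Rightarrow> bool" where
  "smoothm S F \<longleftrightarrow> (\<forall>j k. smooth_on S (\<lambda>y. F y $ j $ k))"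

lemma mm_nth: "(A ** B) $ i $ k = (\<^bold>\<Sum>j. A $ i $ j * B $ j $ k)"
  by (simp add: matrix_matrix_mult_def)

lemma transpose_nth: "transpose A $ i $ j = A $ j $ i"
  by (simp add: transpose_def)

lemma mm_minus: "(A :: real^'k^'k) ** (- B) = - (A ** B)" "(- A) ** B = - (A ** B)"
  by (simp_all add: vec_eq_iff mm_nth sum_negf)

lemma mm_diff: "(A :: real^'k^'k) ** (B - C) = A ** B - A ** C" "(A - B) ** C = A ** C - B ** C"
  by (simp_all add: vec_eq_iff mm_nth sum_subtractf algebra_simps)

lemma mm_add: "(A :: real^'k^'k) ** (B + C) = A ** B + A ** C" "(A + B) ** C = A ** C + B ** C"
  by (simp_all add: vec_eq_iff mm_nth sum.distrib algebra_simps)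

lemma mm_scale: "(A :: real^'k^'k) ** (c *\<^sub>R B) = c *\<^sub>R (A ** B)" "(c *\<^sub>R A) ** B = c *\<^sub>R (A ** B)"
  by (simp_all add: vec_eq_iff mm_nth sum_distrib_left ac_simps)

lemma mm_zero: "(A :: real^'k^'k) ** 0 = 0" "0 ** A = 0"
  by (simp_all add: vec_eq_iff mm_nth)

lemma mm_sum:
  "(A :: real^'k^'k) ** (\<Sum>p\<in>I. B p) = (\<Sum>p\<in>I. A ** B p)"
  "(\<Sum>p\<in>I. B p) ** A = (\<Sum>p\<in>I. B p ** A)"
  by (induction I rule: infinite_finite_induct) (simp_all add: mm_add mm_zero)

lemma transpose_arith:
  "transpose (A + B) = transpose A + transpose (B :: real^'k^'k)"
  "transpose (A - B) = transpose A - transpose (B :: real^'k^'k)"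
  "transpose (- A) = - transpose (A :: real^'k^'k)"
  "transpose (0 :: real^'k^'k) = 0"
  by (simp_all add: vec_eq_iff transpose_nth)

lemma transpose_sum: "transpose (\<Sum>p\<in>I. B p) = (\<Sum>p\<in>I. transpose (B p :: real^'k^'k))"
  by (induction I rule: infinite_finite_induct) (simp_all add: transpose_arith)

lemma trace_arith:
  "trace (- A) = - trace (A :: real^'k^'k)" "trace (c *\<^sub>R A) = c * trace (A :: real^'k^'k)"
  "trace (0 :: real^'k^'k) = 0"
  by (simp_all add: trace_def sum_negf sum_distrib_left)

lemma trace_sum: "trace (\<Sum>p\<in>I. B p) = (\<Sum>p\<in>I. trace (B p :: real^'k^'k))"
  by (induction I rule: infinite_finite_induct) (simp_all add: trace_arith trace_add)

lemmas matrix_simps = mm_add mm_diff mm_minus mm_zero matrix_mul_assoc transpose_arith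
  matrix_transpose_mul

lemma smoothm_mult: "open S \<Longrightarrow> smoothm S F \<Longrightarrow> smoothm S H \<Longrightarrow> smoothm S (\<lambda>y. F y ** H y)"
  by (simp add: smoothm_def mm_nth smooth_on_sum smooth_on_mult)

lemma smoothm_add: "open S \<Longrightarrow> smoothm S F \<Longrightarrow> smoothm S H \<Longrightarrow> smoothm S (\<lambda>y. F y + H y)"
  by (simp add: smoothm_def smooth_on_add)

lemma smoothm_diff: "open S \<Longrightarrow> smoothm S F \<Longrightarrow> smoothm S H \<Longrightarrow> smoothm S (\<lambda>y. F y - H y)"
  by (simp add: smoothm_def smooth_on_diff)

lemma smoothm_transpose: "smoothm S F \<Longrightarrow> smoothm S (\<lambda>y. transpose (F y))"
  by (simp add: smoothm_def transpose_nth)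

lemma smoothm_pdm: "smoothm S F \<Longrightarrow> smoothm S (pdm i F)"
  using smooth_on_pd by (fastforce simp: smoothm_def pdm_def)

lemma smoothm_matrix_inv:
  "open S \<Longrightarrow> smoothm S F \<Longrightarrow> (\<And>y. y \<in> S \<Longrightarrow> invertible (F y)) \<Longrightarrow> smoothm S (\<lambda>y. matrix_inv (F y))"
  by (simp add: smoothm_def smooth_on_matrix_inv)

lemmas smoothm_intros = smoothm_mult smoothm_add smoothm_diff smoothm_transpose smoothm_pdm

lemma smoothm_differentiable:
  "smoothm S F \<Longrightarrow> x \<in> S \<Longrightarrow> (\<lambda>y. F y $ j $ k) differentiable (at x)"
  unfolding smoothm_def using smooth_onD(1) by blast

lemma pdm_cong:
  "open S \<Longrightarrow> x \<in> S \<Longrightarrow> (\<And>y. y \<in> S \<Longrightarrow> F y = H y) \<Longrightarrow> pdm i F x = pdm i H x"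
  unfolding pdm_def vec_eq_iff by (auto intro!: pd_cong[of S x])

lemma pdm_const: "pdm i (\<lambda>y. C) x = 0"
  by (simp add: pdm_def vec_eq_iff pd_const)

lemma pdm_transpose: "pdm i (\<lambda>y. transpose (F y)) x = transpose (pdm i F x)"
  by (simp add: pdm_def vec_eq_iff transpose_nth)

lemma pd_minus: "f differentiable (at x) \<Longrightarrow> pd i (\<lambda>x. - f x) x = - pd i f x"
  using pd_mult[of "\<lambda>x. -1" x f i] by (simp add: pd_const)

lemma pd_diff:
  "f differentiable (at x) \<Longrightarrow> g differentiable (at x) \<Longrightarrow> pd i (\<lambda>x. f x - g x) x = pd i f x - pd i g x"
  using pd_add[of f x "\<lambda>x. - g x" i] pd_minus[of g x i] by simp

lemma pdm_add:
  "smoothm S F \<Longrightarrow> smoothm S H \<Longrightarrow> x \<in> S \<Longrightarrow> pdm i (\<lambda>y. F y + H y) x = pdm i F x + pdm i H x"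
  by (simp add: pdm_def vec_eq_iff pd_add smoothm_differentiable)

lemma pdm_diff:
  "smoothm S F \<Longrightarrow> smoothm S H \<Longrightarrow> x \<in> S \<Longrightarrow> pdm i (\<lambda>y. F y - H y) x = pdm i F x - pdm i H x"
  by (simp add: pdm_def vec_eq_iff pd_diff smoothm_differentiable)

lemma pdm_minus: "smoothm S F \<Longrightarrow> x \<in> S \<Longrightarrow> pdm i (\<lambda>y. - F y) x = - pdm i F x"
  by (simp add: pdm_def vec_eq_iff pd_minus smoothm_differentiable)

lemma pdm_mult:
  "smoothm S F \<Longrightarrow> smoothm S H \<Longrightarrow> x \<in> S \<Longrightarrow>
    pdm i (\<lambda>y. F y ** H y) x = pdm i F x ** H x + F x ** pdm i H x"
  by (simp add: pdm_def vec_eq_iff mm_nth pd_sum pd_mult smoothm_differentiable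
      differentiable_mult sum.distrib)

lemma pdm_commute:
  "open S \<Longrightarrow> x \<in> S \<Longrightarrow> smoothm S F \<Longrightarrow> pdm i (pdm j F) x = pdm j (pdm i F) x"
  by (simp add: pdm_def smoothm_def vec_eq_iff pd_commute)

lemma pd_trace:
  "smoothm S F \<Longrightarrow> x \<in> S \<Longrightarrow> pd i (\<lambda>y. trace (F y)) x = trace (pdm i F x)"
  by (simp add: trace_def pdm_def pd_sum smoothm_differentiable)

section \<open>Torsion-free connections in a chart\<close>

definition field_matrix :: "'m comp2 \<Rightarrow> real^'m \<Rightarrow> real^'m^'m" where
  "field_matrix T x = (\<chi> i j. T x i j)"

text \<open>Rows carry the lower index and columns the upper one. On a covariant 2-tensor, left
  multiplication by this matrix therefore gives the correction for the first index, and right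
  multiplication by its transpose the correction for the second.\<close>

definition conn_matrix :: "'m comp3 \<Rightarrow> 'm \<Rightarrow> real^'m \<Rightarrow> real^'m^'m" where
  "conn_matrix G i x = (\<chi> j k. G x i j k)"

definition riem_matrix :: "'m::finite comp3 \<Rightarrow> 'm \<Rightarrow> 'm \<Rightarrow> real^'m \<Rightarrow> real^'m^'m" where
  "riem_matrix G i j x = (\<chi> p k. riem G x i j p k)"

lemma field_matrix_nth: "field_matrix T x $ i $ j = T x i j"
  by (simp add: field_matrix_def)

lemma cov_2_matrix:
  "cov_2 G T x i j k =
    (pdm i (field_matrix T) x - conn_matrix G i x ** field_matrix T x
      - field_matrix T x ** transpose (conn_matrix G i x)) $ j $ k"
  by (simp add: cov_2_def pdm_def field_matrix_def conn_matrix_def mm_nth transpose_nth ac_simps)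

lemma riem_antisym: "riem G x i j k l = - riem G x j i k l"
  by (simp add: riem_def)

lemma riem_matrix_antisym: "riem_matrix G i j x = - riem_matrix G j i x"
  by (simp add: riem_matrix_def vec_eq_iff riem_antisym[of G x i j])

locale torsion_free_chart =
  fixes S :: "(real^'m::finite) set" and G :: "'m comp3"
  assumes open_S: "open S"
    and smooth_G: "\<And>i j k. smooth_on S (\<lambda>y. G y i j k)"
    and torsion: "\<And>x i j k. x \<in> S \<Longrightarrow> G x i j k = G x j i k"
begin

abbreviation "\<Gamma> \<equiv> conn_matrix G"
abbreviation "R \<equiv> riem_matrix G"

lemma G_differentiable: "x \<in> S \<Longrightarrow> (\<lambda>y. G y i j k) differentiable (at x)"
  using smooth_onD(1)[OF smooth_G] .

lemma smoothm_conn: "smoothm S (\<Gamma> i)"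
  by (simp add: smoothm_def conn_matrix_def smooth_G)

text \<open>The quadratic terms appear in the reverse of the customary order because lower indices
  label rows, so these matrices act on row vectors.\<close>

lemma riem_matrix_eq:
  assumes "x \<in> S"
  shows "R i j x = pdm i (\<Gamma> j) x - pdm j (\<Gamma> i) x + \<Gamma> j x ** \<Gamma> i x - \<Gamma> i x ** \<Gamma> j x"
  unfolding riem_matrix_def riem_expand[OF G_differentiable[OF assms] torsion[OF assms]]
  by (simp add: vec_eq_iff pdm_def conn_matrix_def mm_nth ac_simps)

lemma smooth_riem: "smooth_on S (\<lambda>y. riem G y i j k l)"
proof (rule smooth_on_cong[OF open_S])
  show "smooth_on S (\<lambda>x. pd i (\<lambda>y. G y j k l) x - pd j (\<lambda>y. G y i k l) x
    + (\<^bold>\<Sum>q. G x i q l * G x j k q) - (\<^bold>\<Sum>q. G x j q l * G x i k q))"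
    by (intro smooth_on_intros open_S smooth_G)
qed (simp add: riem_expand G_differentiable torsion[symmetric])

lemma smoothm_riem: "smoothm S (R i j)"
  by (simp add: smoothm_def riem_matrix_def smooth_riem)

lemma smooth_ric: "smooth_on S (\<lambda>y. ric G y i j)"
  unfolding ric_def by (intro smooth_on_intros open_S smooth_riem)

lemma first_bianchi:
  assumes "x \<in> S"
  shows "riem G x i j k l + riem G x j k i l + riem G x k i j l = 0"
proof -
  \<comment> \<open>The symmetry of the Christoffel symbols holds on all of the open set
    \<open>S\<close>, so it may be differentiated.\<close>
  have t: "pd a (\<lambda>y. G y b c d) x = pd a (\<lambda>y. G y c b d) x" for a b c d
    by (rule pd_cong[OF open_S assms torsion])
  show ?thesis
    unfolding riem_expand[OF G_differentiable[OF assms] torsion[OF assms]]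
    using t[of i j k l] t[of j k i l] t[of k i j l] torsion[OF assms, of i j]
      torsion[OF assms, of j k] torsion[OF assms, of k i] by simp
qed

text \<open>The curvature annihilates a parallel tensor: substitute the expression for the first
  derivatives of \<open>T\<close> into both mixed second derivatives and use that these agree. It is
  applied to \<open>g\<close> and to \<open>\<Omega>\<close>.\<close>

lemma ricci_identity_parallel:
  assumes T: "smoothm S T"
    and par: "\<And>y i. y \<in> S \<Longrightarrow> pdm i T y = \<Gamma> i y ** T y + T y ** transpose (\<Gamma> i y)"
    and x: "x \<in> S"
  shows "R i j x ** T x + T x ** transpose (R i j x) = 0"
proof -
  note sm = T smoothm_conn smoothm_intros open_S
  have d: "pdm i (pdm j T) x = pdm i (\<Gamma> j) x ** T x + \<Gamma> j x ** (\<Gamma> i x ** T x + T x ** transpose (\<Gamma> i x))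
      + (\<Gamma> i x ** T x + T x ** transpose (\<Gamma> i x)) ** transpose (\<Gamma> j x)
      + T x ** transpose (pdm i (\<Gamma> j) x)" for i j
  proof -
    have "pdm i (pdm j T) x = pdm i (\<lambda>y. \<Gamma> j y ** T y + T y ** transpose (\<Gamma> j y)) x"
      by (rule pdm_cong[OF open_S x par])
    also have "\<dots> = pdm i (\<lambda>y. \<Gamma> j y ** T y) x + pdm i (\<lambda>y. T y ** transpose (\<Gamma> j y)) x"
      by (rule pdm_add[of S]) (intro sm x)+
    also have "pdm i (\<lambda>y. \<Gamma> j y ** T y) x = pdm i (\<Gamma> j) x ** T x + \<Gamma> j x ** pdm i T x"
      by (rule pdm_mult[of S]) (intro sm x)+
    also have "pdm i (\<lambda>y. T y ** transpose (\<Gamma> j y)) x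
        = pdm i T x ** transpose (\<Gamma> j x) + T x ** pdm i (\<lambda>y. transpose (\<Gamma> j y)) x"
      by (rule pdm_mult[of S]) (intro sm x)+
    finally show ?thesis by (simp add: par[OF x] pdm_transpose)
  qed
  have "pdm i (pdm j T) x = pdm j (pdm i T) x"
    by (rule pdm_commute[OF open_S x T])
  then show ?thesis
    unfolding d riem_matrix_eq[OF x] by (simp add: matrix_simps algebra_simps)
qed

text \<open>This is the covariant derivative in direction \<open>m\<close> of the curvature, as a
  matrix in its last two indices. The two sums correct for \<open>i\<close> and \<open>j\<close>,
  the commutator with \<open>\<Gamma> m x\<close> for the endomorphism indices.\<close>

definition cov_riem :: "'m \<Rightarrow> 'm \<Rightarrow> 'm \<Rightarrow> real^'m \<Rightarrow> real^'m^'m" where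
  "cov_riem m i j x = pdm m (R i j) x
     - (\<Sum>p\<in>UNIV. G x m i p *\<^sub>R R p j x) - (\<Sum>p\<in>UNIV. G x m j p *\<^sub>R R i p x)
     - \<Gamma> m x ** R i j x + R i j x ** \<Gamma> m x"

lemma second_bianchi:
  assumes x: "x \<in> S"
  shows "cov_riem m i j x + cov_riem i j m x + cov_riem j m i x = 0"
proof -
  note sm = smoothm_conn smoothm_intros open_S
  have dR: "pdm m (R i j) x = pdm m (pdm i (\<Gamma> j)) x - pdm m (pdm j (\<Gamma> i)) x
      + (pdm m (\<Gamma> j) x ** \<Gamma> i x + \<Gamma> j x ** pdm m (\<Gamma> i) x)
      - (pdm m (\<Gamma> i) x ** \<Gamma> j x + \<Gamma> i x ** pdm m (\<Gamma> j) x)" for m i j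
  proof -
    have "pdm m (R i j) x = pdm m (\<lambda>x. pdm i (\<Gamma> j) x - pdm j (\<Gamma> i) x + \<Gamma> j x ** \<Gamma> i x
        - \<Gamma> i x ** \<Gamma> j x) x"
      by (rule pdm_cong[OF open_S x riem_matrix_eq])
    also have "\<dots> = pdm m (\<lambda>x. pdm i (\<Gamma> j) x - pdm j (\<Gamma> i) x + \<Gamma> j x ** \<Gamma> i x) x
        - pdm m (\<lambda>x. \<Gamma> i x ** \<Gamma> j x) x"
      by (rule pdm_diff[of S]) (intro sm x)+
    also have "pdm m (\<lambda>x. pdm i (\<Gamma> j) x - pdm j (\<Gamma> i) x + \<Gamma> j x ** \<Gamma> i x) x
        = pdm m (\<lambda>x. pdm i (\<Gamma> j) x - pdm j (\<Gamma> i) x) x + pdm m (\<lambda>x. \<Gamma> j x ** \<Gamma> i x) x"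
      by (rule pdm_add[of S]) (intro sm x)+
    also have "pdm m (\<lambda>x. pdm i (\<Gamma> j) x - pdm j (\<Gamma> i) x) x
        = pdm m (pdm i (\<Gamma> j)) x - pdm m (pdm j (\<Gamma> i)) x"
      by (rule pdm_diff[of S]) (intro sm x)+
    finally show ?thesis by (simp add: pdm_mult[OF smoothm_conn smoothm_conn x])
  qed
  \<comment> \<open>\<open>C\<close> is covariant in the endomorphism indices only. Its cyclic sum
    is the Bianchi identity of the curvature form and vanishes by commuting partial derivatives and
    associativity.\<close>
  define C where "C m i j = pdm m (R i j) x - \<Gamma> m x ** R i j x + R i j x ** \<Gamma> m x" for m i j
  have C: "C m i j + C i j m + C j m i = 0"
    unfolding C_def dR riem_matrix_eq[OF x]
      pdm_commute[OF open_S x smoothm_conn, of i m] pdm_commute[OF open_S x smoothm_conn, of j m]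
      pdm_commute[OF open_S x smoothm_conn, of j i]
    by (simp add: matrix_simps algebra_simps)
  \<comment> \<open>\<open>L\<close> holds the corrections for the form indices. In the cyclic sum
    each Christoffel symbol multiplies a curvature matrix and the same matrix with its form indices
    exchanged, which cancel.\<close>
  define L where "L m i j = (\<Sum>p\<in>UNIV. G x m i p *\<^sub>R R p j x + G x m j p *\<^sub>R R i p x)" for m i j
  have L: "L m i j + L i j m + L j m i = 0"
    unfolding L_def sum.distrib[symmetric]
  proof (intro sum.neutral ballI)
    fix p
    have "G x i m p = G x m i p" "G x j m p = G x m j p" "G x j i p = G x i j p"
      by (rule torsion[OF x])+
    moreover have "R p j x = - R j p x" "R p i x = - R i p x" "R p m x = - R m p x"
      by (rule riem_matrix_antisym)+
    ultimately show "G x m i p *\<^sub>R R p j x + G x m j p *\<^sub>R R i p x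
        + (G x i j p *\<^sub>R R p m x + G x i m p *\<^sub>R R j p x)
        + (G x j m p *\<^sub>R R p i x + G x j i p *\<^sub>R R m p x) = 0"
      by simp
  qed
  have "cov_riem m i j x = C m i j - L m i j" for m i j
    by (simp add: cov_riem_def C_def L_def sum.distrib)
  then have "cov_riem m i j x + cov_riem i j m x + cov_riem j m i x
      = (C m i j + C i j m + C j m i) - (L m i j + L i j m + L j m i)"
    by simp
  then show ?thesis by (simp add: C L)
qed

text \<open>Contraction commutes with covariant differentiation: the corrections for the contracted
  lower and upper index cancel (fact \<open>3\<close>), and the others are those of the Ricci
  tensor.\<close>

lemma cov_ric_eq:
  assumes x: "x \<in> S"
  shows "cov_2 G (ric G) x m j k = (\<^bold>\<Sum>i. cov_riem m i j x $ k $ i)"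
proof -
  have dif: "(\<lambda>y. riem G y a b c d) differentiable (at x)" for a b c d
    using smooth_onD(1)[OF smooth_riem x] .
  have 1: "pd m (\<lambda>y. ric G y j k) x = (\<^bold>\<Sum>i. pd m (\<lambda>y. riem G y i j k i) x)"
    unfolding ric_def by (simp add: pd_sum dif)
  have 2: "(\<^bold>\<Sum>i. cov_riem m i j x $ k $ i) =
      (\<^bold>\<Sum>i. pd m (\<lambda>y. riem G y i j k i) x) - (\<^bold>\<Sum>i p. G x m i p * riem G x p j k i)
      - (\<^bold>\<Sum>i p. G x m j p * riem G x i p k i)
      - (\<^bold>\<Sum>i p. G x m k p * riem G x i j p i) + (\<^bold>\<Sum>i p. riem G x i j k p * G x m p i)"
    by (simp add: cov_riem_def pdm_def riem_matrix_def conn_matrix_def mm_nth sum.distrib sum_subtractf)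
  have 3: "(\<^bold>\<Sum>i p. riem G x i j k p * G x m p i) = (\<^bold>\<Sum>i p. G x m i p * riem G x p j k i)"
    by (subst sum.swap) (simp add: mult.commute)
  have 4: "(\<^bold>\<Sum>i p. G x m j p * riem G x i p k i) = (\<^bold>\<Sum>p. G x m j p * ric G x p k)"
    unfolding ric_def sum_distrib_left by (rule sum.swap)
  have 5: "(\<^bold>\<Sum>i p. G x m k p * riem G x i j p i) = (\<^bold>\<Sum>p. G x m k p * ric G x j p)"
    unfolding ric_def sum_distrib_left by (rule sum.swap)
  show ?thesis unfolding 2 3 4 5 cov_2_def 1 by simp
qed

end

section \<open>Kaehler structures in a chart\<close>

text \<open>Alternating the two symmetries six times returns to the original order of the indices
  with the opposite sign, as in the uniqueness of the Levi-Civita connection.\<close>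

lemma sym_skew_zero:
  fixes f :: "'b \<Rightarrow> 'b \<Rightarrow> 'b \<Rightarrow> real"
  assumes "\<And>i j l. f i j l = f j i l" "\<And>i j l. f i j l = - f i l j"
  shows "f i j l = 0"
  using assms(1)[of i j l] assms(2)[of j i l] assms(1)[of j l i] assms(2)[of l j i]
    assms(1)[of l i j] assms(2)[of i l j] by linarith

lemma matrix_inv_unique:
  fixes B C :: "real^'k^'k"
  assumes "B ** C = mat 1"
  shows "matrix_inv B = C"
proof -
  have "invertible B" using assms invertible_right_inverse by blast
  then have "C = (matrix_inv B ** B) ** C" by (simp add: matrix_inv_right_left)
  then show ?thesis using assms by (simp flip: matrix_mul_assoc)
qed

text \<open>The Kaehler and Levi-Civita data as seen in one chart. Only \<open>g\<close> is parallel
  by assumption; smoothness of \<open>g\<close>, and parallelism of \<open>J\<close> and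
  \<open>\<Omega>\<close>, are derived.\<close>

locale kaehler_chart = torsion_free_chart S G for S :: "(real^'m::finite) set" and G +
  fixes g J \<Omega> :: "'m comp2"
  assumes smooth_J: "\<And>i j. smooth_on S (\<lambda>y. J y i j)"
    and smooth_Omega: "\<And>i j. smooth_on S (\<lambda>y. \<Omega> y i j)"
    and Omega_skew: "\<And>x i j. x \<in> S \<Longrightarrow> \<Omega> x i j = - \<Omega> x j i"
    and Omega_closed: "\<And>x i j k. x \<in> S \<Longrightarrow>
      pd i (\<lambda>y. \<Omega> y j k) x + pd j (\<lambda>y. \<Omega> y k i) x + pd k (\<lambda>y. \<Omega> y i j) x = 0"
    and J_square: "\<And>x i j. x \<in> S \<Longrightarrow> (\<^bold>\<Sum>p. J x i p * J x p j) = (if i = j then - 1 else 0)"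
    and J_integrable: "\<And>x i j k. x \<in> S \<Longrightarrow> nijenhuis J x i j k = 0"
    and g_eq: "\<And>x i j. x \<in> S \<Longrightarrow> g x i j = - (\<^bold>\<Sum>p. J x i p * \<Omega> x p j)"
    and g_sym: "\<And>x i j. x \<in> S \<Longrightarrow> g x i j = g x j i"
    and g_pos: "\<And>x X. x \<in> S \<Longrightarrow> \<exists>i. X i \<noteq> 0 \<Longrightarrow> (\<^bold>\<Sum>i j. X i * X j * g x i j) > 0"
    and g_parallel: "\<And>x i j k. x \<in> S \<Longrightarrow> cov_2 G g x i j k = 0"
begin

abbreviation "h \<equiv> field_matrix g"
abbreviation "I \<equiv> field_matrix J"
abbreviation "W \<equiv> field_matrix \<Omega>"
abbreviation "u x \<equiv> matrix_inv (h x)"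

lemma smooth_g: "smooth_on S (\<lambda>y. g y i j)"
proof (rule smooth_on_cong[OF open_S])
  show "smooth_on S (\<lambda>y. - (\<^bold>\<Sum>p. J y i p * \<Omega> y p j))"
    by (intro smooth_on_intros open_S smooth_J smooth_Omega)
qed (simp add: g_eq)

lemma smoothm_h: "smoothm S h" and smoothm_I: "smoothm S I" and smoothm_W: "smoothm S W"
  by (simp_all add: smoothm_def field_matrix_def smooth_g smooth_J smooth_Omega)

lemma I_square: "x \<in> S \<Longrightarrow> I x ** I x = - mat 1"
  by (simp add: vec_eq_iff mm_nth field_matrix_def J_square mat_def)

lemma h_eq: "x \<in> S \<Longrightarrow> h x = - (I x ** W x)"
  by (simp add: vec_eq_iff mm_nth field_matrix_def g_eq)

lemma h_transpose: "x \<in> S \<Longrightarrow> transpose (h x) = h x"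
  using g_sym by (simp add: vec_eq_iff transpose_nth field_matrix_def)

lemma W_transpose: "x \<in> S \<Longrightarrow> transpose (W x) = - W x"
  by (auto simp: vec_eq_iff transpose_nth field_matrix_def intro: Omega_skew)

lemma I_h: "x \<in> S \<Longrightarrow> I x ** h x = W x"
  by (simp add: h_eq matrix_simps I_square)

lemma h_I: "x \<in> S \<Longrightarrow> h x ** transpose (I x) = - W x"
  using arg_cong[OF I_h[of x], of transpose] by (simp add: matrix_transpose_mul h_transpose W_transpose)

lemma h_invertible:
  assumes "x \<in> S"
  shows "invertible (h x)"
  unfolding invertible_left_inverse matrix_left_invertible_ker
proof (intro allI impI, rule ccontr)
  fix v assume v: "h x *v v = 0" "v \<noteq> 0"
  have "(\<^bold>\<Sum>j. g x i j * v $ j) = 0" for i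
    using v(1) by (simp add: vec_eq_iff matrix_vector_mult_def field_matrix_def)
  moreover have "(\<^bold>\<Sum>i j. v $ i * v $ j * g x i j) = (\<^bold>\<Sum>i. v $ i * (\<^bold>\<Sum>j. g x i j * v $ j))"
    by (simp add: sum_distrib_left ac_simps)
  ultimately have "(\<^bold>\<Sum>i j. v $ i * v $ j * g x i j) = 0" by simp
  moreover have "\<exists>i. v $ i \<noteq> 0" using v(2) by (auto simp: vec_eq_iff)
  ultimately show False using g_pos[OF assms, of "\<lambda>i. v $ i"] by simp
qed

lemma h_u: "x \<in> S \<Longrightarrow> h x ** u x = mat 1" and u_h: "x \<in> S \<Longrightarrow> u x ** h x = mat 1"
  by (simp_all add: matrix_inv_right_left h_invertible)

lemma u_transpose: "x \<in> S \<Longrightarrow> transpose (u x) = u x"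
  using matrix_inv_unique[of "h x" "transpose (u x)"] arg_cong[OF u_h[of x], of transpose]
  by (simp add: matrix_transpose_mul h_transpose)

lemma smoothm_u: "smoothm S u"
  by (simp add: smoothm_matrix_inv open_S smoothm_h h_invertible)

text \<open>Since \<open>\<Omega>\<close> is \<open>J\<close> times \<open>g\<close> and the inverse
  of \<open>J\<close> is its negative, the inverse matrix of \<open>\<Omega>\<close> is
  \<open>- (u x ** I x)\<close>; the sign built into \<open>symp_up\<close> cancels the
  minus.\<close>

lemma symp_up_eq:
  assumes "x \<in> S"
  shows "symp_up \<Omega> x i j = (u x ** I x) $ i $ j"
proof -
  have "W x ** (- (u x ** I x)) = - (I x ** (h x ** u x) ** I x)"
    by (simp add: I_h[OF assms, symmetric] matrix_simps)
  also have "\<dots> = mat 1" by (simp add: h_u assms I_square)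
  finally have "matrix_inv (W x) = - (u x ** I x)" by (rule matrix_inv_unique)
  then show ?thesis by (simp add: symp_up_def field_matrix_def)
qed

subsection \<open>The complex structure and the symplectic form are parallel\<close>

lemma pdm_h: "x \<in> S \<Longrightarrow> pdm i h x = \<Gamma> i x ** h x + h x ** transpose (\<Gamma> i x)"
  using g_parallel unfolding cov_2_matrix vec_eq_iff by (fastforce simp: algebra_simps)

text \<open>The inverse metric is parallel, as one sees by differentiating
  \<open>h y ** u y = mat 1\<close>.\<close>

lemma pdm_u:
  assumes x: "x \<in> S"
  shows "pdm i u x = - (transpose (\<Gamma> i x) ** u x + u x ** \<Gamma> i x)"
proof -
  have "pdm i (\<lambda>y. h y ** u y) x = pdm i (\<lambda>y. mat 1) x"
    by (rule pdm_cong[OF open_S x h_u])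
  then have "pdm i h x ** u x + h x ** pdm i u x = 0"
    by (simp add: pdm_const pdm_mult[OF smoothm_h smoothm_u x])
  then have "h x ** pdm i u x = - (pdm i h x ** u x)" by (simp add: eq_neg_iff_add_eq_0 add.commute)
  then have "u x ** h x ** pdm i u x = - (u x ** (pdm i h x ** u x))"
    by (simp add: mm_minus flip: matrix_mul_assoc)
  moreover have "u x ** (pdm i h x ** u x) = u x ** \<Gamma> i x ** (h x ** u x) + (u x ** h x) ** transpose (\<Gamma> i x) ** u x"
    by (simp add: pdm_h[OF x] matrix_simps)
  ultimately show ?thesis by (simp add: h_u u_h x)
qed

definition cov_J :: "'m \<Rightarrow> real^'m \<Rightarrow> real^'m^'m" where
  "cov_J i x = pdm i I x - \<Gamma> i x ** I x + I x ** \<Gamma> i x"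

definition cov_Omega :: "'m \<Rightarrow> real^'m \<Rightarrow> real^'m^'m" where
  "cov_Omega i x = pdm i W x - \<Gamma> i x ** W x - W x ** transpose (\<Gamma> i x)"

lemma cov_Omega_eq:
  assumes x: "x \<in> S"
  shows "cov_Omega i x = cov_J i x ** h x"
proof -
  have "pdm i W x = pdm i (\<lambda>y. I y ** h y) x"
    by (rule pdm_cong[OF open_S x]) (simp add: I_h)
  also have "\<dots> = pdm i I x ** h x + I x ** pdm i h x"
    by (rule pdm_mult[OF smoothm_I smoothm_h x])
  finally show ?thesis
    by (simp add: cov_Omega_def cov_J_def I_h[OF x, symmetric] pdm_h[OF x] matrix_simps)
qed

text \<open>Differentiate \<open>J\<close> squared equals minus the identity; the Christoffel terms
  cancel.\<close>

lemma cov_J_anticommute: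
  assumes x: "x \<in> S"
  shows "I x ** cov_J i x = - (cov_J i x ** I x)"
proof -
  have "pdm i (\<lambda>y. I y ** I y) x = pdm i (\<lambda>y. - mat 1) x"
    by (rule pdm_cong[OF open_S x I_square])
  then have "pdm i I x ** I x + I x ** pdm i I x = 0"
    by (simp add: pdm_const pdm_mult[OF smoothm_I smoothm_I x])
  moreover have "I x ** \<Gamma> i x ** I x + - (\<Gamma> i x ** I x ** I x) + (I x ** I x ** \<Gamma> i x - I x ** \<Gamma> i x ** I x) = 0"
    by (simp add: I_square[OF x] mm_minus flip: matrix_mul_assoc)
  ultimately show ?thesis
    unfolding cov_J_def eq_neg_iff_add_eq_0 by (simp add: matrix_simps algebra_simps)
qed

text \<open>The lowered form of the anticommutation: \<open>J\<close> may be moved from one slot of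
  the derivative of \<open>\<Omega>\<close> to the other.\<close>

lemma cov_Omega_I:
  assumes x: "x \<in> S"
  shows "cov_Omega i x ** transpose (I x) = I x ** cov_Omega i x"
proof -
  have "cov_Omega i x ** transpose (I x) = - (cov_J i x ** W x)"
    by (simp add: cov_Omega_eq[OF x] h_I[OF x] mm_minus flip: matrix_mul_assoc)
  also have "\<dots> = (- (cov_J i x ** I x)) ** h x"
    by (simp add: I_h[OF x, symmetric] matrix_simps)
  also have "\<dots> = (I x ** cov_J i x) ** h x"
    by (simp only: cov_J_anticommute[OF x])
  finally show ?thesis
    by (simp only: cov_Omega_eq[OF x] matrix_mul_assoc)
qed

lemma cov_Omega_transpose:
  assumes x: "x \<in> S"
  shows "transpose (cov_Omega i x) = - cov_Omega i x"
proof -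
  have "pdm i (\<lambda>y. transpose (W y)) x = pdm i (\<lambda>y. - W y) x"
    by (rule pdm_cong[OF open_S x]) (rule W_transpose)
  then have "transpose (pdm i W x) = - pdm i W x"
    by (simp only: pdm_transpose pdm_minus[OF smoothm_W x])
  then show ?thesis
    by (simp add: cov_Omega_def transpose_arith matrix_transpose_mul W_transpose[OF x] mm_minus)
qed

text \<open>Without torsion the exterior derivative of a 2-form is the cyclic sum of its covariant
  derivatives: the Christoffel terms cancel in pairs.\<close>

lemma cov_Omega_cyclic:
  assumes x: "x \<in> S"
  shows "cov_Omega i x $ j $ k + cov_Omega j x $ k $ i + cov_Omega k x $ i $ j = 0"
proof -
  have a: "(W x ** transpose (\<Gamma> i x)) $ j $ k = - (\<Gamma> i x ** W x) $ k $ j" for i j k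
  proof -
    have "W x ** transpose (\<Gamma> i x) = - transpose (\<Gamma> i x ** W x)"
      by (simp add: matrix_transpose_mul W_transpose[OF x] mm_minus)
    then show ?thesis by (simp add: transpose_nth)
  qed
  have b: "(\<Gamma> i x ** W x) $ j $ k = (\<Gamma> j x ** W x) $ i $ k" for i j k
    by (simp add: mm_nth conn_matrix_def torsion[OF x, of i j])
  have "pdm i W x $ j $ k + pdm j W x $ k $ i + pdm k W x $ i $ j = 0"
    using Omega_closed[OF x] by (simp add: pdm_def field_matrix_def)
  then show ?thesis
    unfolding cov_Omega_def using a b[of i j k] b[of j k i] b[of k i j] by simp
qed

lemma nijenhuis_eq:
  "nijenhuis J x i j k =
    (\<^bold>\<Sum>p. J x i p * pdm p I x $ j $ k) - (\<^bold>\<Sum>p. J x j p * pdm p I x $ i $ k)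
    + (pdm j I x ** I x) $ i $ k - (pdm i I x ** I x) $ j $ k"
proof -
  have c: "(\<^bold>\<Sum>p. coord_field a y p * f p) = f a" for a y and f :: "'m \<Rightarrow> real"
    by (simp add: coord_field_def if_distrib[of "\<lambda>z. z * _"] cong: if_cong)
  have JX: "apply_endo J (coord_field a) = (\<lambda>y k. J y a k)" for a
    by (simp add: apply_endo_def fun_eq_iff c)
  have z: "pd a (\<lambda>y. coord_field b y k) x = 0" for a b k
    by (simp add: coord_field_def pd_const)
  show ?thesis
    unfolding nijenhuis_def Let_def JX
    by (simp add: lie_bracket_def apply_endo_def z c sum_subtractf sum_negf pdm_def
        field_matrix_def mm_nth)
qed

text \<open>Partial derivatives in the Nijenhuis tensor may be replaced by covariant ones. By
  symmetry of the Christoffel symbols the extra terms cancel: \<open>a\<close> matches a term with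
  one twice multiplied by \<open>J\<close>, while \<open>b\<close> and \<open>c\<close> are
  symmetric in \<open>i\<close> and \<open>j\<close> and enter antisymmetrized.\<close>

lemma nijenhuis_cov:
  assumes x: "x \<in> S"
  shows "(\<^bold>\<Sum>p. J x i p * cov_J p x $ j $ k) - (\<^bold>\<Sum>p. J x j p * cov_J p x $ i $ k)
    + (cov_J j x ** I x) $ i $ k - (cov_J i x ** I x) $ j $ k = 0"
proof -
  have d: "pdm a I x = cov_J a x + \<Gamma> a x ** I x - I x ** \<Gamma> a x" for a
    by (simp add: cov_J_def)
  have a: "(\<^bold>\<Sum>p. J x i p * (\<Gamma> p x ** I x) $ j $ k) = (I x ** \<Gamma> j x ** I x) $ i $ k" for i j
  proof -
    have "(\<Gamma> p x ** I x) $ j $ k = (\<Gamma> j x ** I x) $ p $ k" for p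
      by (simp add: mm_nth conn_matrix_def torsion[OF x, of p j])
    then show ?thesis
      by (simp add: mm_nth[of "I x"] field_matrix_nth flip: matrix_mul_assoc)
  qed
  have b: "(\<^bold>\<Sum>p. J x i p * (I x ** \<Gamma> p x) $ j $ k) = (\<^bold>\<Sum>p. J x j p * (I x ** \<Gamma> p x) $ i $ k)"
    unfolding mm_nth sum_distrib_left
    by (subst sum.swap, intro sum.cong refl)
      (simp add: field_matrix_def conn_matrix_def torsion[OF x] mult.left_commute)
  have c: "(\<Gamma> j x ** I x ** I x) $ i $ k = (\<Gamma> i x ** I x ** I x) $ j $ k"
    by (simp add: I_square[OF x] mm_minus conn_matrix_def torsion[OF x, of j i] flip: matrix_mul_assoc)
  show ?thesis
    using J_integrable[OF x, of i j k] a[of i j] a[of j i] b c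
    unfolding nijenhuis_eq d
    by (simp add: matrix_simps distrib_left right_diff_distrib sum.distrib sum_subtractf)
qed

text \<open>
  With \<open>B\<^sub>i = \<nabla>\<^sub>i \<Omega>\<close>, integrability makes \<open>C\<^sub>i\<^sub>j\<^sub>l = J\<^sub>i\<^sup>p B\<^sub>p\<^sub>j\<^sub>l + J\<^sub>l\<^sup>p B\<^sub>i\<^sub>j\<^sub>p\<close> symmetric in \<open>ij\<close>, and it is
  skew in \<open>jl\<close>, so it vanishes. Inserting \<open>J\<close> into the cyclic identity expressing that \<open>\<Omega>\<close> is closed
  then gives \<open>T\<^sub>i\<^sub>j\<^sub>l = T\<^sub>j\<^sub>l\<^sub>i + T\<^sub>l\<^sub>i\<^sub>j\<close> for \<open>T\<^sub>i\<^sub>j\<^sub>l = J\<^sub>j\<^sup>p B\<^sub>i\<^sub>p\<^sub>l\<close>, whence \<open>T = 0\<close>.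
\<close>

lemma cov_Omega_zero:
  assumes x: "x \<in> S"
  shows "cov_Omega i x = 0"
proof -
  define B where "B = (\<lambda>i. cov_Omega i x)"
  define P where "P i = (\<Sum>p\<in>UNIV. J x i p *\<^sub>R B p)" for i
  define C where "C i = P i + B i ** transpose (I x)" for i
  have P: "(\<^bold>\<Sum>k. (\<^bold>\<Sum>p. J x i p * cov_J p x $ j $ k) * h x $ k $ l) = P i $ j $ l" for i j l
  proof -
    have "P i = (\<Sum>p\<in>UNIV. J x i p *\<^sub>R cov_J p x) ** h x"
      by (simp add: P_def B_def cov_Omega_eq[OF x] mm_sum mm_scale)
    then show ?thesis by (simp add: mm_nth)
  qed
  have Q: "(\<^bold>\<Sum>k. (cov_J j x ** I x) $ i $ k * h x $ k $ l) = - (B j ** transpose (I x)) $ i $ l" for i j l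
  proof -
    have "cov_J j x ** I x ** h x = - (B j ** transpose (I x))"
      by (simp add: B_def cov_Omega_eq[OF x] h_I[OF x] I_h[OF x] mm_minus flip: matrix_mul_assoc)
    then show ?thesis by (simp flip: mm_nth)
  qed
  \<comment> \<open>Lowering the free upper index of the Nijenhuis identity with the metric turns it
    into this symmetry, by \<open>P\<close> and \<open>Q\<close>.\<close>
  have "C i $ j $ l = C j $ i $ l" for i j l
  proof -
    have "0 = (\<^bold>\<Sum>k. ((\<^bold>\<Sum>p. J x i p * cov_J p x $ j $ k) - (\<^bold>\<Sum>p. J x j p * cov_J p x $ i $ k)
        + (cov_J j x ** I x) $ i $ k - (cov_J i x ** I x) $ j $ k) * h x $ k $ l)"
      by (simp add: nijenhuis_cov[OF x])
    also have "\<dots> = P i $ j $ l - P j $ i $ l - (B j ** transpose (I x)) $ i $ l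
        + (B i ** transpose (I x)) $ j $ l"
      by (simp only: left_diff_distrib distrib_right sum.distrib sum_subtractf P Q)
    finally show ?thesis by (simp add: C_def)
  qed
  moreover have "C i $ j $ l = - C i $ l $ j" for i j l
  proof -
    have "transpose (P i) = - P i"
      by (simp add: P_def transpose_sum transpose_scalar B_def cov_Omega_transpose[OF x] sum_negf)
    moreover have "transpose (B i ** transpose (I x)) = - (B i ** transpose (I x))"
      by (simp add: B_def matrix_transpose_mul cov_Omega_transpose[OF x] mm_minus cov_Omega_I[OF x])
    ultimately have "transpose (C i) = - C i" by (simp add: C_def transpose_arith)
    then show ?thesis by (metis transpose_nth vector_uminus_component)
  qed
  ultimately have "C i $ j $ l = 0" for i j l
    using sym_skew_zero[of "\<lambda>i j l. C i $ j $ l"] by blast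
  then have C: "P i $ j $ l = - (B i ** transpose (I x)) $ j $ l" for i j l
    by (simp add: C_def add_eq_0_iff2)
  define T where "T i j l = (I x ** B i) $ j $ l" for i j l
  have T': "(B i ** transpose (I x)) $ j $ l = T i j l" for i j l
    by (simp add: T_def B_def cov_Omega_I[OF x])
  have cyc: "- T i j l + T j l i + T l i j = 0" for i j l
  \<comment> \<open>The cyclic identity is contracted with \<open>J\<close> in the index
    \<open>i\<close>. The vanishing of \<open>C\<close> rewrites the term in which \<open>J\<close>
    meets the derivative index, which is the source of the minus sign.\<close>
  proof -
    have "0 = (\<^bold>\<Sum>p. J x i p * (B p $ j $ l + B j $ l $ p + B l $ p $ j))"
      by (simp add: B_def cov_Omega_cyclic[OF x])
    also have "\<dots> = P i $ j $ l + (B j ** transpose (I x)) $ l $ i + (I x ** B l) $ i $ j"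
      by (simp add: P_def mm_nth transpose_nth field_matrix_def sum.distrib distrib_left ac_simps)
    finally show ?thesis by (simp add: C T' T_def[symmetric])
  qed
  \<comment> \<open>Adding two of the three rotated identities leaves twice a single component of
    \<open>T\<close>.\<close>
  have "T i j l = 0" for i j l
    using cyc[of i j l] cyc[of j l i] cyc[of l i j] by linarith
  then have "I x ** B i = 0" for i by (simp add: vec_eq_iff T_def)
  then have "I x ** I x ** B i = 0" by (simp add: mm_zero flip: matrix_mul_assoc)
  then show ?thesis by (simp add: I_square[OF x] mm_minus B_def)
qed

lemma pdm_W: "x \<in> S \<Longrightarrow> pdm i W x = \<Gamma> i x ** W x + W x ** transpose (\<Gamma> i x)"
  using cov_Omega_zero[of x i] by (simp add: cov_Omega_def algebra_simps)

lemma pdm_I: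
  assumes "x \<in> S"
  shows "pdm i I x = \<Gamma> i x ** I x - I x ** \<Gamma> i x"
proof -
  have "cov_J i x ** (h x ** u x) = 0"
    using cov_Omega_eq[OF assms, of i] cov_Omega_zero[OF assms, of i]
    by (simp add: matrix_mul_assoc mm_zero)
  then show ?thesis by (simp add: h_u assms cov_J_def algebra_simps)
qed

end

section \<open>Symmetries and J-invariance of the curvature and the Ricci tensor\<close>

lemma curvature_pair_symmetry:
  fixes f :: "'b \<Rightarrow> 'b \<Rightarrow> 'b \<Rightarrow> 'b \<Rightarrow> real"
  assumes a1: "\<And>i j k l. f i j k l = - f j i k l" and a2: "\<And>i j k l. f i j k l = - f i j l k"
    and b: "\<And>i j k l. f i j k l + f j k i l + f k i j l = 0"
  shows "f i j k l = f k l i j"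
  \<comment> \<open>One cyclic identity for each choice of the index in last position. Once the
    antisymmetries are applied, a signed combination of the four leaves only the two components to
    be compared.\<close>
  using b[of i j k l] b[of j k l i] b[of k l i j] b[of l i j k]
    a2[of j k l i] a2[of k l j i] a1[of l j k i] a2[of j l k i] a2[of l i k j]
    a1[of i k l j] a2[of k i l j] a2[of i j l k] by linarith

definition cov_ric :: "'m::finite comp3 \<Rightarrow> 'm \<Rightarrow> real^'m \<Rightarrow> real^'m^'m" where
  "cov_ric G m x = (\<chi> j k. cov_2 G (ric G) x m j k)"

lemma cov_ric_matrix:
  "cov_ric G m x = pdm m (field_matrix (ric G)) x - conn_matrix G m x ** field_matrix (ric G) x
      - field_matrix (ric G) x ** transpose (conn_matrix G m x)"
  by (simp add: cov_ric_def vec_eq_iff cov_2_matrix)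

lemma trace_mult: "trace (A ** B) = (\<^bold>\<Sum>i j. A $ i $ j * B $ j $ i)"
  by (simp add: trace_def mm_nth)

lemma metric_up_eq: "metric_up g x i j = matrix_inv (field_matrix g x) $ i $ j"
  by (simp add: metric_up_def field_matrix_def)

context kaehler_chart
begin

abbreviation "Rc \<equiv> field_matrix (ric G)"

lemma u_I: "x \<in> S \<Longrightarrow> transpose (I x) ** u x = - (u x ** I x)"
proof -
  assume x: "x \<in> S"
  have "u x ** (h x ** transpose (I x)) ** u x = - (u x ** (I x ** h x) ** u x)"
    by (simp add: h_I[OF x] I_h[OF x] mm_minus)
  then have "(u x ** h x) ** transpose (I x) ** u x = - (u x ** I x ** (h x ** u x))"
    by (simp add: matrix_mul_assoc)
  then show ?thesis by (simp add: h_u u_h x)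
qed

text \<open>The inverse metric is Hermitian. This is the identity by which the second
  \<open>J\<close> cancels the first in the derivative term.\<close>

lemma I_u_I: "x \<in> S \<Longrightarrow> transpose (I x) ** (u x ** I x) = u x"
  by (simp add: matrix_mul_assoc u_I mm_minus) (simp add: I_square mm_minus flip: matrix_mul_assoc)

lemma riem_h_transpose:
  assumes x: "x \<in> S"
  shows "h x ** transpose (R i j x) = - (R i j x ** h x)"
  using ricci_identity_parallel[OF smoothm_h pdm_h x, of i j] by (simp add: eq_neg_iff_add_eq_0 add.commute)

text \<open>The curvature annihilates both \<open>g\<close> and \<open>\<Omega>\<close>, and
  \<open>\<Omega>\<close> is \<open>J\<close> times \<open>g\<close>; cancelling the invertible
  \<open>g\<close> leaves the commutator with \<open>J\<close>.\<close>

lemma riem_I: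
  assumes x: "x \<in> S"
  shows "I x ** R i j x = R i j x ** I x"
proof -
  have "R i j x ** (I x ** h x) + I x ** (h x ** transpose (R i j x)) = 0"
    using ricci_identity_parallel[OF smoothm_W pdm_W x, of i j] by (simp add: I_h[OF x, symmetric] matrix_mul_assoc)
  then have "R i j x ** I x ** h x = I x ** R i j x ** h x"
    by (simp add: riem_h_transpose[OF x] mm_minus matrix_mul_assoc)
  then have "R i j x ** I x ** (h x ** u x) = I x ** R i j x ** (h x ** u x)"
    by (simp add: matrix_mul_assoc)
  then show ?thesis by (simp add: h_u x)
qed

text \<open>The last index is lowered with \<open>g\<close> here, in contrast to
  \<open>riem_symp\<close>, which uses \<open>\<Omega>\<close>; only this version has the classical
  pair symmetry.\<close>

definition riem_low :: "real^'m \<Rightarrow> 'm \<Rightarrow> 'm \<Rightarrow> 'm \<Rightarrow> 'm \<Rightarrow> real" where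
  "riem_low x i j k l = (R i j x ** h x) $ k $ l"

lemma riem_low_antisym12: "riem_low x i j k l = - riem_low x j i k l"
  by (simp add: riem_low_def riem_matrix_antisym[of G i j] mm_minus)

lemma riem_low_antisym34: "x \<in> S \<Longrightarrow> riem_low x i j k l = - riem_low x i j l k"
proof -
  assume x: "x \<in> S"
  have "transpose (R i j x ** h x) = - (R i j x ** h x)"
    by (simp add: matrix_transpose_mul h_transpose[OF x] riem_h_transpose[OF x])
  then have "transpose (R i j x ** h x) $ l $ k = - (R i j x ** h x) $ l $ k" by simp
  then show ?thesis by (simp add: riem_low_def transpose_nth)
qed

lemma riem_low_bianchi:
  assumes x: "x \<in> S"
  shows "riem_low x i j k l + riem_low x j k i l + riem_low x k i j l = 0"
proof -
  have "riem_low x i j k l + riem_low x j k i l + riem_low x k i j l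
      = (\<^bold>\<Sum>p. (riem G x i j k p + riem G x j k i p + riem G x k i j p) * h x $ p $ l)"
    by (simp add: riem_low_def mm_nth riem_matrix_def sum.distrib distrib_right)
  then show ?thesis by (simp add: first_bianchi[OF x])
qed

lemma riem_low_pair: "x \<in> S \<Longrightarrow> riem_low x i j k l = riem_low x k l i j"
  using curvature_pair_symmetry[of "riem_low x"] riem_low_antisym12 riem_low_antisym34
    riem_low_bianchi by blast

lemma riem_raise:
  assumes x: "x \<in> S"
  shows "riem G x i j k p = (\<^bold>\<Sum>l. riem_low x i j k l * u x $ l $ p)"
proof -
  have "R i j x = R i j x ** h x ** u x"
    by (simp add: h_u[OF x] flip: matrix_mul_assoc)
  then have "R i j x $ k $ p = (\<^bold>\<Sum>l. riem_low x i j k l * u x $ l $ p)"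
    by (metis (no_types, lifting) mm_nth riem_low_def sum.cong)
  then show ?thesis by (simp add: riem_matrix_def)
qed

lemma u_sym: "x \<in> S \<Longrightarrow> u x $ i $ j = u x $ j $ i"
  by (metis u_transpose transpose_nth)

lemma ric_sym:
  assumes x: "x \<in> S"
  shows "ric G x i j = ric G x j i"
proof -
  have r: "riem_low x p i j l = riem_low x l j i p" for p l
    using riem_low_pair[OF x, of p i j l] riem_low_antisym12[of x j l p i]
      riem_low_antisym34[OF x, of l j p i] by simp
  have "ric G x i j = (\<^bold>\<Sum>p l. riem_low x l j i p * u x $ p $ l)"
    by (simp add: ric_def riem_raise[OF x] r u_sym[OF x, of _ _])
  also have "\<dots> = (\<^bold>\<Sum>l p. riem_low x l j i p * u x $ p $ l)"
    by (rule sum.swap)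
  finally show ?thesis by (simp add: ric_def riem_raise[OF x])
qed

text \<open>Invariance in the last pair is immediate, since the curvature endomorphisms commute with
  \<open>J\<close>. Pair symmetry transfers it to the first pair.\<close>

lemma riem_low_J_invariant:
  assumes x: "x \<in> S"
  shows "(\<^bold>\<Sum>a b. J x i a * J x j b * riem_low x a b k l) = riem_low x i j k l"
proof -
  have "I x ** (R k l x ** h x) ** transpose (I x) = (I x ** R k l x) ** (h x ** transpose (I x))"
    by (simp add: matrix_mul_assoc)
  also have "\<dots> = - (R k l x ** (I x ** I x) ** h x)"
    by (simp add: riem_I[OF x] h_I[OF x] I_h[OF x, symmetric] mm_minus matrix_mul_assoc)
  also have "\<dots> = R k l x ** h x" by (simp add: I_square[OF x] mm_minus)
  finally have "(I x ** (R k l x ** h x) ** transpose (I x)) $ i $ j = riem_low x k l i j"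
    by (simp add: riem_low_def)
  moreover have "(I x ** (R k l x ** h x) ** transpose (I x)) $ i $ j
      = (\<^bold>\<Sum>b a. J x i a * J x j b * riem_low x k l a b)"
    unfolding mm_nth[of "I x ** _"] mm_nth[of "I x"]
    by (simp add: transpose_nth field_matrix_nth riem_low_def sum_distrib_left ac_simps)
  ultimately show ?thesis
    by (subst sum.swap) (simp add: riem_low_pair[OF x, of _ _ k l] riem_low_pair[OF x, of i j])
qed

lemma riem_J_invariant:
  assumes x: "x \<in> S"
  shows "(\<^bold>\<Sum>a b. J x i a * J x j b * riem G x a b k l) = riem G x i j k l"
proof -
  have "(\<^bold>\<Sum>a b. J x i a * J x j b * riem G x a b k l)
      = (\<^bold>\<Sum>a b p. (J x i a * J x j b * riem_low x a b k p) * u x $ p $ l)"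
    by (simp add: riem_raise[OF x] sum_distrib_left ac_simps)
  also have "\<dots> = (\<^bold>\<Sum>a p b. (J x i a * J x j b * riem_low x a b k p) * u x $ p $ l)"
    by (intro sum.cong refl sum.swap)
  also have "\<dots> = (\<^bold>\<Sum>p a b. (J x i a * J x j b * riem_low x a b k p) * u x $ p $ l)"
    by (rule sum.swap)
  also have "\<dots> = (\<^bold>\<Sum>p. riem_low x i j k p * u x $ p $ l)"
    by (simp add: riem_low_J_invariant[OF x] flip: sum_distrib_right)
  finally show ?thesis by (simp add: riem_raise[OF x])
qed

text \<open>By \<open>c\<close>, the \<open>J\<close> acting on the third curvature index passes to
  the contracted upper index. It then sits, together with the other \<open>J\<close>, on the first
  pair, where the curvature is invariant.\<close>

lemma ric_J_invariant:
  assumes x: "x \<in> S"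
  shows "(\<^bold>\<Sum>a b. J x i a * J x j b * ric G x a b) = ric G x i j"
proof -
  have c: "(\<^bold>\<Sum>b. J x j b * riem G x p a b p) = (\<^bold>\<Sum>q. riem G x p a j q * J x q p)" for p a
  proof -
    have "(I x ** R p a x) $ j $ p = (R p a x ** I x) $ j $ p" by (simp only: riem_I[OF x])
    then show ?thesis by (simp add: mm_nth field_matrix_nth riem_matrix_def)
  qed
  have "(\<^bold>\<Sum>a b. J x i a * J x j b * ric G x a b)
      = (\<^bold>\<Sum>a b p. J x i a * (J x j b * riem G x p a b p))"
    by (simp add: ric_def sum_distrib_left ac_simps)
  also have "\<dots> = (\<^bold>\<Sum>a p b. J x i a * (J x j b * riem G x p a b p))"
    by (intro sum.cong refl sum.swap)
  also have "\<dots> = (\<^bold>\<Sum>a p q. J x q p * J x i a * riem G x p a j q)"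
    by (simp add: c sum_distrib_left ac_simps flip: sum_distrib_left[of "J x i _"])
  also have "\<dots> = (\<^bold>\<Sum>a q p. J x q p * J x i a * riem G x p a j q)"
    by (intro sum.cong refl sum.swap)
  also have "\<dots> = (\<^bold>\<Sum>q a p. J x q p * J x i a * riem G x p a j q)"
    by (rule sum.swap)
  also have "\<dots> = (\<^bold>\<Sum>q p a. J x q p * J x i a * riem G x p a j q)"
    by (intro sum.cong refl sum.swap)
  also have "\<dots> = ric G x i j"
    by (simp add: riem_J_invariant[OF x] ric_def)
  finally show ?thesis .
qed

lemma Rc_transpose: "x \<in> S \<Longrightarrow> transpose (Rc x) = Rc x"
  using ric_sym by (simp add: vec_eq_iff transpose_nth field_matrix_nth)

lemma smoothm_Rc: "smoothm S Rc"
  by (simp add: smoothm_def field_matrix_nth smooth_ric)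

text \<open>J-invariance in a form linear in \<open>J\<close>, which is easier to differentiate than
  the quadratic one.\<close>

lemma Rc_I:
  assumes x: "x \<in> S"
  shows "I x ** Rc x + Rc x ** transpose (I x) = 0"
proof -
  have "I x ** Rc x ** transpose (I x) = Rc x"
  proof -
    have "(I x ** Rc x ** transpose (I x)) $ i $ j = (\<^bold>\<Sum>b a. J x i a * J x j b * ric G x a b)" for i j
      by (simp add: mm_nth transpose_nth field_matrix_nth sum_distrib_left ac_simps)
    moreover have "\<dots> i j = ric G x i j" for i j
      by (subst sum.swap) (rule ric_J_invariant[OF x])
    ultimately show ?thesis by (simp add: vec_eq_iff field_matrix_nth)
  qed
  then have "Rc x ** transpose (I x) = I x ** Rc x ** transpose (I x ** I x)"
    by (metis matrix_mul_assoc matrix_transpose_mul)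
  then show ?thesis by (simp add: I_square[OF x] transpose_arith mm_minus)
qed

lemma cov_ric_transpose:
  assumes x: "x \<in> S"
  shows "transpose (cov_ric G m x) = cov_ric G m x"
proof -
  have "pdm m (\<lambda>y. transpose (Rc y)) x = pdm m Rc x"
    by (rule pdm_cong[OF open_S x]) (rule Rc_transpose)
  then show ?thesis
    by (simp add: cov_ric_matrix transpose_arith matrix_transpose_mul Rc_transpose[OF x] pdm_transpose)
qed

lemma cov_ric_I:
  assumes x: "x \<in> S"
  shows "cov_ric G m x ** transpose (I x) = - (I x ** cov_ric G m x)"
proof -
  note sm = smoothm_Rc smoothm_I smoothm_intros open_S
  have "pdm m (\<lambda>y. I y ** Rc y + Rc y ** transpose (I y)) x = pdm m (\<lambda>y. 0) x"
    by (rule pdm_cong[OF open_S x]) (rule Rc_I)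
  moreover have "pdm m (\<lambda>y. I y ** Rc y + Rc y ** transpose (I y)) x
      = pdm m (\<lambda>y. I y ** Rc y) x + pdm m (\<lambda>y. Rc y ** transpose (I y)) x"
    by (rule pdm_add[of S]) (intro sm x)+
  moreover have "pdm m (\<lambda>y. I y ** Rc y) x = pdm m I x ** Rc x + I x ** pdm m Rc x"
    by (rule pdm_mult[of S]) (intro sm x)+
  moreover have "pdm m (\<lambda>y. Rc y ** transpose (I y)) x
      = pdm m Rc x ** transpose (I x) + Rc x ** pdm m (\<lambda>y. transpose (I y)) x"
    by (rule pdm_mult[of S]) (intro sm x)+
  ultimately have 0: "pdm m I x ** Rc x + I x ** pdm m Rc x + (pdm m Rc x ** transpose (I x)
      + Rc x ** transpose (pdm m I x)) = 0"
    by (simp add: pdm_const pdm_transpose)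
  have 1: "pdm m Rc x = cov_ric G m x + \<Gamma> m x ** Rc x + Rc x ** transpose (\<Gamma> m x)"
    by (simp add: cov_ric_matrix)
  \<comment> \<open>Because \<open>J\<close> is parallel, all Christoffel terms regroup into
    multiples of the relation being differentiated.\<close>
  have 2: "I x ** cov_ric G m x + cov_ric G m x ** transpose (I x)
      + (\<Gamma> m x ** (I x ** Rc x + Rc x ** transpose (I x))
      + (I x ** Rc x + Rc x ** transpose (I x)) ** transpose (\<Gamma> m x)) = 0"
    using 0 unfolding 1 pdm_I[OF x] by (simp add: matrix_simps algebra_simps)
  show ?thesis
    using 2 unfolding Rc_I[OF x] by (simp add: mm_zero eq_neg_iff_add_eq_0 add.commute)
qed

text \<open>The hypothesis \<open>par\<close> says that the contravariant tensor \<open>P\<close> is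
  parallel, so only the covariant derivative of \<open>X\<close> survives. \<open>P\<close> will be
  the inverse metric and the inverse symplectic form; cyclicity of the trace moves the Christoffel
  terms of \<open>P\<close> onto \<open>X\<close>.\<close>

lemma pd_contract:
  assumes P: "smoothm S P" and X: "smoothm S X" and x: "x \<in> S"
    and par: "pdm m P x = - (transpose (\<Gamma> m x) ** P x + P x ** \<Gamma> m x)"
  shows "pd m (\<lambda>y. trace (P y ** X y)) x
    = trace (P x ** (pdm m X x - \<Gamma> m x ** X x - X x ** transpose (\<Gamma> m x)))"
proof -
  have "pd m (\<lambda>y. trace (P y ** X y)) x = trace (pdm m P x ** X x + P x ** pdm m X x)"
    by (simp add: pd_trace[OF smoothm_mult[OF open_S P X] x] pdm_mult[OF P X x])
  moreover have "trace (transpose (\<Gamma> m x) ** P x ** X x) = trace (P x ** X x ** transpose (\<Gamma> m x))"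
    by (subst trace_mul_sym) (simp add: matrix_mul_assoc trace_mul_sym[of "transpose (\<Gamma> m x)"])
  ultimately show ?thesis
    by (simp add: par matrix_simps trace_add trace_sub trace_arith)
qed

lemma scal_eq:
  assumes "x \<in> S"
  shows "scal g G x = trace (u x ** Rc x)"
  by (simp add: scal_def metric_up_eq trace_mult field_matrix_nth ric_sym[OF assms])

lemma pd_scal:
  assumes x: "x \<in> S"
  shows "pd m (scal g G) x = trace (u x ** cov_ric G m x)"
proof -
  have "pd m (scal g G) x = pd m (\<lambda>y. trace (u y ** Rc y)) x"
    by (rule pd_cong[OF open_S x scal_eq])
  then show ?thesis
    by (simp add: pd_contract[OF smoothm_u smoothm_Rc x pdm_u[OF x]] cov_ric_matrix)
qed

subsection \<open>The contracted second Bianchi identity\<close>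

lemma cov_riem_antisym12:
  assumes x: "x \<in> S"
  shows "cov_riem m i j x = - cov_riem m j i x"
proof -
  have R: "R a b x = - R b a x" for a b by (rule riem_matrix_antisym)
  have "pdm m (R i j) x = pdm m (\<lambda>y. - R j i y) x"
    by (rule pdm_cong[OF open_S x]) (rule riem_matrix_antisym)
  then have "pdm m (R i j) x = - pdm m (R j i) x"
    by (simp add: pdm_minus[OF smoothm_riem x])
  then show ?thesis
    unfolding cov_riem_def by (simp add: R[of i j] R[of _ j] R[of i _] mm_minus sum_negf)
qed

text \<open>Differentiate the skewness of the lowered curvature. The Christoffel terms of the last
  pair regroup into the relation \<open>N\<close> itself, and \<open>L\<close> satisfies the same
  relation, being a combination of curvature matrices.\<close>

lemma cov_riem_h_transpose:
  assumes x: "x \<in> S"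
  shows "transpose (cov_riem m i j x ** h x) = - (cov_riem m i j x ** h x)"
proof -
  note sm = smoothm_riem smoothm_h smoothm_intros open_S
  define L where "L = (\<Sum>p\<in>UNIV. G x m i p *\<^sub>R R p j x) + (\<Sum>p\<in>UNIV. G x m j p *\<^sub>R R i p x)"
  define N where "N = R i j x ** h x + h x ** transpose (R i j x)"
  have N: "N = 0" by (simp add: N_def riem_h_transpose[OF x])
  have L: "h x ** transpose L = - (L ** h x)"
    by (simp add: L_def transpose_arith transpose_sum transpose_scalar mm_add mm_sum mm_scale
        riem_h_transpose[OF x] sum_negf)
  have "pdm m (\<lambda>y. R i j y ** h y + h y ** transpose (R i j y)) x = pdm m (\<lambda>y. 0) x"
    by (rule pdm_cong[OF open_S x]) (simp add: riem_h_transpose)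
  moreover have "pdm m (\<lambda>y. R i j y ** h y + h y ** transpose (R i j y)) x
      = pdm m (\<lambda>y. R i j y ** h y) x + pdm m (\<lambda>y. h y ** transpose (R i j y)) x"
    by (rule pdm_add[of S]) (intro sm x)+
  moreover have "pdm m (\<lambda>y. R i j y ** h y) x = pdm m (R i j) x ** h x + R i j x ** pdm m h x"
    by (rule pdm_mult[of S]) (intro sm x)+
  moreover have "pdm m (\<lambda>y. h y ** transpose (R i j y)) x
      = pdm m h x ** transpose (R i j x) + h x ** pdm m (\<lambda>y. transpose (R i j y)) x"
    by (rule pdm_mult[of S]) (intro sm x)+
  ultimately have 0: "pdm m (R i j) x ** h x + R i j x ** pdm m h x
      + (pdm m h x ** transpose (R i j x) + h x ** transpose (pdm m (R i j) x)) = 0"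
    by (simp add: pdm_const pdm_transpose)
  have 1: "pdm m (R i j) x = cov_riem m i j x + L + \<Gamma> m x ** R i j x - R i j x ** \<Gamma> m x"
    by (simp add: cov_riem_def L_def)
  have 2: "cov_riem m i j x ** h x + h x ** transpose (cov_riem m i j x)
      + (L ** h x + h x ** transpose L) + (\<Gamma> m x ** N + N ** transpose (\<Gamma> m x)) = 0"
    using 0 unfolding 1 pdm_h[OF x] N_def by (simp add: matrix_simps algebra_simps)
  then have "h x ** transpose (cov_riem m i j x) = - (cov_riem m i j x ** h x)"
    by (simp add: N L mm_zero eq_neg_iff_add_eq_0 add.commute)
  then show ?thesis by (simp add: matrix_transpose_mul h_transpose[OF x])
qed

text \<open>Contracting the second Bianchi identity twice gives the differential of the scalar
  curvature from one term and minus the divergence of the Ricci tensor from each of the other two,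
  hence the factor one half.\<close>

lemma contracted_bianchi:
  assumes x: "x \<in> S"
  shows "(\<^bold>\<Sum>q j. u x $ q $ j * cov_ric G q x $ a $ j) = 1/2 * pd a (scal g G) x"
proof -
  define D where "D m i j k l = (cov_riem m i j x ** h x) $ k $ l" for m i j k l
  have D34: "D m i j k l = - D m i j l k" for m i j k l
    by (metis D_def cov_riem_h_transpose[OF x] transpose_nth vector_uminus_component)
  have D12: "D m i j k l = - D m j i k l" for m i j k l
    by (simp add: D_def cov_riem_antisym12[OF x, of m i j] mm_minus)
  have bianchi: "D m i j k l + D i j m k l + D j m i k l = 0" for m i j k l
    using second_bianchi[OF x, of m i j]
    by (simp add: D_def flip: vector_add_component mm_add)
  have T: "(\<^bold>\<Sum>i l. u x $ i $ l * D m i j k l) = cov_ric G m x $ j $ k" for m j k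
  proof -
    have "cov_riem m i j x $ k $ i = (\<^bold>\<Sum>l. u x $ i $ l * D m i j k l)" for i
    proof -
      have "cov_riem m i j x = (cov_riem m i j x ** h x) ** u x"
        by (simp add: h_u[OF x] flip: matrix_mul_assoc)
      then have "cov_riem m i j x $ k $ i = (\<^bold>\<Sum>l. D m i j k l * u x $ l $ i)"
        by (metis (no_types, lifting) D_def mm_nth sum.cong)
      then show ?thesis by (simp add: u_sym[OF x, of _ i] mult.commute)
    qed
    then show ?thesis by (simp add: cov_ric_def cov_ric_eq[OF x])
  qed
  define v where "v = (\<^bold>\<Sum>q j. u x $ q $ j * cov_ric G q x $ a $ j)"
  have 1: "(\<^bold>\<Sum>j k i l. u x $ j $ k * (u x $ i $ l * D a i j k l)) = pd a (scal g G) x"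
  proof -
    have "(\<^bold>\<Sum>j k i l. u x $ j $ k * (u x $ i $ l * D a i j k l)) = (\<^bold>\<Sum>j k. u x $ j $ k * cov_ric G a x $ j $ k)"
      by (simp add: T flip: sum_distrib_left)
    also have "\<dots> = trace (u x ** transpose (cov_ric G a x))"
      by (simp add: trace_mult transpose_nth)
    finally show ?thesis by (simp add: pd_scal[OF x] cov_ric_transpose[OF x])
  qed
  have 2: "(\<^bold>\<Sum>j k i l. u x $ j $ k * (u x $ i $ l * D j a i k l)) = - v"
    by (simp add: D12[of _ a] sum_negf T v_def flip: sum_distrib_left)
  have 3: "(\<^bold>\<Sum>j k i l. u x $ j $ k * (u x $ i $ l * D i j a k l)) = - v"
  proof -
    have "(\<^bold>\<Sum>j k i l. u x $ j $ k * (u x $ i $ l * D i j a k l))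
        = (\<^bold>\<Sum>j i k l. u x $ j $ k * (u x $ i $ l * D i j a k l))"
      by (intro sum.cong refl sum.swap)
    also have "\<dots> = (\<^bold>\<Sum>i j k l. u x $ j $ k * (u x $ i $ l * D i j a k l))"
      by (rule sum.swap)
    also have "\<dots> = (\<^bold>\<Sum>i j l k. u x $ j $ k * (u x $ i $ l * D i j a k l))"
      by (intro sum.cong refl sum.swap)
    also have "\<dots> = (\<^bold>\<Sum>i l j k. u x $ j $ k * (u x $ i $ l * D i j a k l))"
      by (intro sum.cong refl sum.swap)
    also have "\<dots> = (\<^bold>\<Sum>i l j k. u x $ i $ l * (u x $ j $ k * - D i j a l k))"
      by (intro sum.cong refl) (subst D34, simp)
    also have "\<dots> = - v"
      by (simp add: sum_negf T v_def flip: sum_distrib_left)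
    finally show ?thesis .
  qed
  have "0 = (\<^bold>\<Sum>j k i l. u x $ j $ k * (u x $ i $ l * (D a i j k l + D i j a k l + D j a i k l)))"
    by (simp add: bianchi)
  also have "\<dots> = pd a (scal g G) x - v - v"
    by (simp only: distrib_left sum.distrib 1 2 3)
  finally show ?thesis by (simp add: v_def)
qed

end

section \<open>Contractions\<close>

lemma quad_sum: "(\<^bold>\<Sum>p q. A $ i $ p * B $ j $ q * f p q) = (A ** (\<chi> p q. f p q) ** transpose B) $ i $ j"
proof -
  have "(A ** (\<chi> p q. f p q) ** transpose B) $ i $ j = (\<^bold>\<Sum>q p. A $ i $ p * B $ j $ q * f p q)"
    by (simp add: mm_nth transpose_nth sum_distrib_left ac_simps)
  also have "\<dots> = (\<^bold>\<Sum>p q. A $ i $ p * B $ j $ q * f p q)" by (rule sum.swap)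
  finally show ?thesis by simp
qed

lemma trace_mult_transpose: "trace (A ** transpose B) = (\<^bold>\<Sum>i j. A $ i $ j * B $ i $ j)"
  by (simp add: trace_mult transpose_nth)

lemma sum_swap_pairs:
  "(\<Sum>k\<in>K. \<Sum>l\<in>L. \<Sum>p\<in>P. \<Sum>q\<in>Q. f k l p q) = (\<Sum>p\<in>P. \<Sum>q\<in>Q. \<Sum>k\<in>K. \<Sum>l\<in>L. f k l p q)"
proof -
  have "(\<Sum>k\<in>K. \<Sum>l\<in>L. \<Sum>p\<in>P. \<Sum>q\<in>Q. f k l p q) = (\<Sum>k\<in>K. \<Sum>p\<in>P. \<Sum>l\<in>L. \<Sum>q\<in>Q. f k l p q)"
    by (intro sum.cong refl sum.swap)
  also have "\<dots> = (\<Sum>p\<in>P. \<Sum>k\<in>K. \<Sum>l\<in>L. \<Sum>q\<in>Q. f k l p q)" by (rule sum.swap)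
  also have "\<dots> = (\<Sum>p\<in>P. \<Sum>k\<in>K. \<Sum>q\<in>Q. \<Sum>l\<in>L. f k l p q)"
    by (intro sum.cong refl sum.swap)
  also have "\<dots> = (\<Sum>p\<in>P. \<Sum>q\<in>Q. \<Sum>k\<in>K. \<Sum>l\<in>L. f k l p q)"
    by (intro sum.cong refl sum.swap)
  finally show ?thesis .
qed

definition ip2 :: "real^'m^'m \<Rightarrow> ('m::finite \<Rightarrow> 'm \<Rightarrow> real) \<Rightarrow> ('m \<Rightarrow> 'm \<Rightarrow> real) \<Rightarrow> real" where
  "ip2 v T Q = (\<^bold>\<Sum>i j p q. v $ i $ p * v $ j $ q * T i j * Q p q)"

definition ip4 :: "real^'m^'m \<Rightarrow> ('m::finite \<Rightarrow> 'm \<Rightarrow> 'm \<Rightarrow> 'm \<Rightarrow> real) \<Rightarrow>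
    ('m \<Rightarrow> 'm \<Rightarrow> 'm \<Rightarrow> 'm \<Rightarrow> real) \<Rightarrow> real" where
  "ip4 v T Q = (\<^bold>\<Sum>i j k l p q r s.
     v $ i $ p * v $ j $ q * v $ k $ r * v $ l $ s * T i j k l * Q p q r s)"

lemma ip2_trace:
  "ip2 v T Q = trace (v ** (\<chi> p q. Q p q) ** transpose v ** transpose (\<chi> p q. T p q))"
proof -
  have "ip2 v T Q = (\<^bold>\<Sum>i j. (\<^bold>\<Sum>p q. v $ i $ p * v $ j $ q * Q p q) * T i j)"
    by (simp add: ip2_def sum_distrib_left ac_simps)
  then show ?thesis by (simp add: quad_sum trace_mult_transpose)
qed

lemma ip4_swap:
  assumes v: "\<And>a b. v $ a $ b = v $ b $ a"
  shows "ip4 v T Q = ip4 v Q T"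
proof -
  have "ip4 v T Q = (\<^bold>\<Sum>i j p q k l r s.
      v $ i $ p * v $ j $ q * v $ k $ r * v $ l $ s * T i j k l * Q p q r s)"
    unfolding ip4_def by (intro sum.cong refl sum_swap_pairs)
  also have "\<dots> = (\<^bold>\<Sum>p q i j k l r s.
      v $ i $ p * v $ j $ q * v $ k $ r * v $ l $ s * T i j k l * Q p q r s)"
    by (rule sum_swap_pairs)
  also have "\<dots> = (\<^bold>\<Sum>p q i j r s k l.
      v $ i $ p * v $ j $ q * v $ k $ r * v $ l $ s * T i j k l * Q p q r s)"
    by (intro sum.cong refl sum_swap_pairs)
  also have "\<dots> = (\<^bold>\<Sum>p q r s i j k l.
      v $ i $ p * v $ j $ q * v $ k $ r * v $ l $ s * T i j k l * Q p q r s)"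
    by (intro sum.cong refl sum_swap_pairs)
  also have "\<dots> = ip4 v Q T"
    unfolding ip4_def
  proof (intro sum.cong refl)
    fix p q r s i j k l
    show "v $ i $ p * v $ j $ q * v $ k $ r * v $ l $ s * T i j k l * Q p q r s
      = v $ p $ i * v $ q $ j * v $ r $ k * v $ s $ l * Q p q r s * T i j k l"
      by (simp add: v[of i p] v[of j q] v[of k r] v[of l s])
  qed
  finally show ?thesis .
qed

lemma ip4_add_right:
  "ip4 v T (\<lambda>i j k l. Q i j k l + Q' i j k l) = ip4 v T Q + ip4 v T Q'"
  by (simp add: ip4_def distrib_left sum.distrib)

lemma ip2_left_diff:
  "ip2 v (\<lambda>i j. T i j - c * T' i j) Q = ip2 v T Q - c * ip2 v T' Q"
  by (simp add: ip2_def right_diff_distrib left_diff_distrib sum_subtractf sum_distrib_left ac_simps)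

lemma ip2_right_diff:
  "ip2 v Q (\<lambda>i j. c * T i j - d * T' i j) = c * ip2 v Q T - d * ip2 v Q T'"
  by (simp add: ip2_def right_diff_distrib sum_subtractf sum_distrib_left ac_simps)

text \<open>For symmetric arguments this is the usual Kulkarni-Nomizu product. In this curvature
  convention the contraction of the first and third lowered indices is minus the Ricci tensor, so
  the Weyl tensor is the curvature plus such a product.\<close>

definition kulkarni :: "real^'m^'m \<Rightarrow> ('m \<Rightarrow> 'm \<Rightarrow> real) \<Rightarrow> 'm \<Rightarrow> 'm \<Rightarrow> 'm \<Rightarrow> 'm \<Rightarrow> real" where
  "kulkarni a P i j k l = a $ k $ i * P j l - a $ k $ j * P i l - a $ l $ i * P j k + a $ l $ j * P i k"

text \<open>Against an array skew in each pair the four terms of the product contribute equally,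
  since their signs are those of the exchanges relating them.\<close>

lemma sum_kulkarni:
  fixes f :: "'b::finite \<Rightarrow> 'b \<Rightarrow> 'b \<Rightarrow> 'b \<Rightarrow> real"
  assumes f1: "\<And>p q r s. f p q r s = - f q p r s" and f2: "\<And>p q r s. f p q r s = - f p q s r"
  shows "(\<^bold>\<Sum>p q r s. f p q r s * kulkarni a P p q r s)
    = 4 * (\<^bold>\<Sum>p q r s. f p q r s * (a $ r $ p * P q s))"
proof -
  let ?N = "\<^bold>\<Sum>p q r s. f p q r s * (a $ r $ p * P q s)"
  have 1: "(\<^bold>\<Sum>p q r s. f p q r s * (a $ r $ q * P p s)) = - ?N"
  proof -
    have "(\<^bold>\<Sum>p q r s. f p q r s * (a $ r $ q * P p s)) = (\<^bold>\<Sum>p q r s. f q p r s * (a $ r $ p * P q s))"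
      by (rule sum.swap)
    also have "\<dots> = (\<^bold>\<Sum>p q r s. - (f p q r s * (a $ r $ p * P q s)))"
      by (intro sum.cong refl) (subst f1, simp)
    finally show ?thesis by (simp add: sum_negf)
  qed
  have swap34: "(\<^bold>\<Sum>p q r s. f p q r s * g p q s r) = - (\<^bold>\<Sum>p q r s. f p q r s * g p q r s)" for g
  proof -
    have "(\<^bold>\<Sum>p q r s. f p q r s * g p q s r) = (\<^bold>\<Sum>p q r s. f p q s r * g p q r s)"
      by (intro sum.cong refl sum.swap)
    also have "\<dots> = (\<^bold>\<Sum>p q r s. - (f p q r s * g p q r s))"
      by (intro sum.cong refl) (subst f2, simp)
    finally show ?thesis by (simp add: sum_negf)
  qed
  have 2: "(\<^bold>\<Sum>p q r s. f p q r s * (a $ s $ p * P q r)) = - ?N"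
    using swap34[of "\<lambda>p q r s. a $ r $ p * P q s"] .
  have 3: "(\<^bold>\<Sum>p q r s. f p q r s * (a $ s $ q * P p r)) = ?N"
    using swap34[of "\<lambda>p q r s. a $ r $ q * P p s"] 1 by simp
  show ?thesis
    by (simp only: kulkarni_def distrib_left right_diff_distrib sum.distrib sum_subtractf 1 2 3)
qed

text \<open>Multiplying by the metric in this product is adjoint, up to the factor 4, to contracting
  the first and third indices. A trace-free \<open>T\<close> is therefore orthogonal to all these
  products. In the proof \<open>X\<close> is \<open>T\<close> with its indices raised.\<close>

lemma ip4_kulkarni:
  fixes v a :: "real^'m::finite^'m" and T :: "'m \<Rightarrow> 'm \<Rightarrow> 'm \<Rightarrow> 'm \<Rightarrow> real"
  assumes v: "\<And>a b. v $ a $ b = v $ b $ a" and inv: "v ** a = mat 1"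
    and T1: "\<And>i j k l. T i j k l = - T j i k l" and T2: "\<And>i j k l. T i j k l = - T i j l k"
  shows "ip4 v T (kulkarni a P) = 4 * ip2 v (\<lambda>j l. \<^bold>\<Sum>i k. v $ i $ k * T i j k l) P"
proof -
  define X where "X p q r s = (\<^bold>\<Sum>i j k l. v $ i $ p * v $ j $ q * v $ k $ r * v $ l $ s * T i j k l)"
    for p q r s
  have X: "ip4 v T Q = (\<^bold>\<Sum>p q r s. X p q r s * Q p q r s)" for Q
  proof -
    have "ip4 v T Q = ip4 v Q T" by (rule ip4_swap[OF v])
    also have "\<dots> = (\<^bold>\<Sum>p q r s. X p q r s * Q p q r s)"
      unfolding ip4_def X_def sum_distrib_right
      by (intro sum.cong refl) (simp add: v ac_simps)
    finally show ?thesis .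
  qed
  have X1: "X p q r s = - X q p r s" for p q r s
  proof -
    have "X p q r s = (\<^bold>\<Sum>i j k l. v $ j $ p * v $ i $ q * v $ k $ r * v $ l $ s * T j i k l)"
      unfolding X_def by (rule sum.swap)
    also have "\<dots> = (\<^bold>\<Sum>i j k l. - (v $ i $ q * v $ j $ p * v $ k $ r * v $ l $ s * T i j k l))"
      by (intro sum.cong refl) (subst T1, simp)
    finally show ?thesis by (simp add: X_def sum_negf)
  qed
  have X2: "X p q r s = - X p q s r" for p q r s
  proof -
    have "X p q r s = (\<^bold>\<Sum>i j k l. v $ i $ p * v $ j $ q * v $ l $ r * v $ k $ s * T i j l k)"
      unfolding X_def by (intro sum.cong refl sum.swap)
    also have "\<dots> = (\<^bold>\<Sum>i j k l. - (v $ i $ p * v $ j $ q * v $ k $ s * v $ l $ r * T i j k l))"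
      by (intro sum.cong refl) (subst T2, simp)
    finally show ?thesis by (simp add: X_def sum_negf)
  qed
  define c where "c j l = (\<^bold>\<Sum>i k. v $ i $ k * T i j k l)" for j l
  have tr: "(\<^bold>\<Sum>p r. (\<^bold>\<Sum>i k. v $ p $ i * v $ r $ k * T i j k l) * a $ r $ p) = c j l" for j l
  proof -
    have "(\<^bold>\<Sum>p r. (\<^bold>\<Sum>i k. v $ p $ i * v $ r $ k * T i j k l) * a $ r $ p)
        = trace (v ** (\<chi> i k. T i j k l) ** transpose v ** a)"
      by (simp add: quad_sum trace_mult)
    also have "transpose v = v" by (simp add: vec_eq_iff transpose_nth v)
    also have "trace (v ** (\<chi> i k. T i j k l) ** v ** a) = trace (v ** (\<chi> i k. T i j k l))"
      by (simp add: inv flip: matrix_mul_assoc)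
    also have "\<dots> = (\<^bold>\<Sum>i k. v $ k $ i * T i j k l)"
      unfolding trace_mult by (subst sum.swap) simp
    finally show ?thesis by (simp add: c_def v[of _ _])
  qed
  have cX: "(\<^bold>\<Sum>p r. X p q r s * a $ r $ p) = (\<^bold>\<Sum>j l. v $ j $ q * v $ l $ s * c j l)" for q s
  proof -
    have "X p q r s = (\<^bold>\<Sum>j l i k. v $ j $ q * v $ l $ s * (v $ p $ i * v $ r $ k * T i j k l))" for p r
    proof -
      have "X p q r s = (\<^bold>\<Sum>j i k l. v $ i $ p * v $ j $ q * v $ k $ r * v $ l $ s * T i j k l)"
        unfolding X_def by (rule sum.swap)
      also have "\<dots> = (\<^bold>\<Sum>j i l k. v $ i $ p * v $ j $ q * v $ k $ r * v $ l $ s * T i j k l)"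
        by (intro sum.cong refl sum.swap)
      also have "\<dots> = (\<^bold>\<Sum>j l i k. v $ i $ p * v $ j $ q * v $ k $ r * v $ l $ s * T i j k l)"
        by (intro sum.cong refl sum.swap)
      also have "\<dots> = (\<^bold>\<Sum>j l i k. v $ j $ q * v $ l $ s * (v $ p $ i * v $ r $ k * T i j k l))"
        by (intro sum.cong refl) (simp add: v[of p] v[of r] ac_simps)
      finally show ?thesis .
    qed
    then have "(\<^bold>\<Sum>p r. X p q r s * a $ r $ p)
        = (\<^bold>\<Sum>p r j l. v $ j $ q * v $ l $ s * ((\<^bold>\<Sum>i k. v $ p $ i * v $ r $ k * T i j k l) * a $ r $ p))"
      by (simp add: sum_distrib_left sum_distrib_right mult.assoc)
    also have "\<dots> = (\<^bold>\<Sum>j l p r. v $ j $ q * v $ l $ s * ((\<^bold>\<Sum>i k. v $ p $ i * v $ r $ k * T i j k l) * a $ r $ p))"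
      by (rule sum_swap_pairs)
    also have "\<dots> = (\<^bold>\<Sum>j l. v $ j $ q * v $ l $ s * c j l)"
      by (simp only: tr sum_distrib_left[symmetric])
    finally show ?thesis .
  qed
  have "(\<^bold>\<Sum>p q r s. X p q r s * (a $ r $ p * P q s)) = (\<^bold>\<Sum>q p r s. X p q r s * (a $ r $ p * P q s))"
    by (rule sum.swap)
  also have "\<dots> = (\<^bold>\<Sum>q p s r. X p q r s * (a $ r $ p * P q s))"
    by (intro sum.cong refl sum.swap)
  also have "\<dots> = (\<^bold>\<Sum>q s p r. X p q r s * (a $ r $ p * P q s))"
    by (intro sum.cong refl sum.swap)
  also have "\<dots> = (\<^bold>\<Sum>q s. (\<^bold>\<Sum>p r. X p q r s * a $ r $ p) * P q s)"
    by (simp add: sum_distrib_right mult.assoc)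
  also have "\<dots> = (\<^bold>\<Sum>q s j l. v $ j $ q * v $ l $ s * c j l * P q s)"
    by (simp add: cX sum_distrib_right)
  also have "\<dots> = ip2 v c P"
    unfolding ip2_def by (rule sum_swap_pairs)
  finally show ?thesis
    by (simp add: X sum_kulkarni[of X, OF X1 X2] c_def[abs_def])
qed

section \<open>Raising indices with the symplectic form, and the evaluation of
  \<open>\<K>\<close>\<close>

context kaehler_chart
begin

abbreviation "U x \<equiv> u x ** I x"

lemma U_transpose: "x \<in> S \<Longrightarrow> transpose (U x) = - U x"
  by (simp add: matrix_transpose_mul u_transpose u_I)

lemma pdm_U:
  assumes x: "x \<in> S"
  shows "pdm m (\<lambda>y. U y) x = - (transpose (\<Gamma> m x) ** U x + U x ** \<Gamma> m x)"
  by (simp add: pdm_mult[OF smoothm_u smoothm_I x] pdm_u[OF x] pdm_I[OF x] matrix_simps)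

text \<open>Conjugation by \<open>U\<close> is conjugation by \<open>J\<close> followed by
  conjugation by \<open>u\<close>, and the first of these fixes a J-invariant array.\<close>

lemma raise_J_invariant:
  assumes x: "x \<in> S" and f: "\<And>i j. (\<^bold>\<Sum>a b. J x i a * J x j b * f a b) = f i j"
  shows "(\<^bold>\<Sum>p q. U x $ i $ p * U x $ j $ q * f p q) = (\<^bold>\<Sum>p q. u x $ i $ p * u x $ j $ q * f p q)"
proof -
  define F where "F = (\<chi> p q. f p q)"
  have "(\<^bold>\<Sum>a b. I x $ i $ a * I x $ j $ b * f a b) = f i j" for i j
    by (simp add: field_matrix_nth f)
  then have "I x ** F ** transpose (I x) = F"
    unfolding quad_sum F_def by (simp add: vec_eq_iff)
  then have "U x ** F ** transpose (U x) = u x ** F ** transpose (u x)"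
    by (metis matrix_mul_assoc matrix_transpose_mul)
  then show ?thesis unfolding quad_sum F_def by simp
qed

lemma raise_ric:
  assumes x: "x \<in> S"
  shows "(\<^bold>\<Sum>i j p q. U x $ i $ p * U x $ j $ q * ric G x p q * ric G x i j) = norm_sq2 g (ric G) x"
proof -
  have "(\<^bold>\<Sum>i j p q. U x $ i $ p * U x $ j $ q * ric G x p q * ric G x i j)
      = (\<^bold>\<Sum>i j. (\<^bold>\<Sum>p q. U x $ i $ p * U x $ j $ q * ric G x p q) * ric G x i j)"
    by (simp add: sum_distrib_right)
  also have "\<dots> = (\<^bold>\<Sum>i j. (\<^bold>\<Sum>p q. u x $ i $ p * u x $ j $ q * ric G x p q) * ric G x i j)"
    by (simp only: raise_J_invariant[OF x ric_J_invariant[OF x]])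
  finally show ?thesis
    by (simp add: norm_sq2_def metric_up_eq sum_distrib_left ac_simps)
qed

text \<open>Both quadratic expressions in the curvature reduce to this: the metric product over the
  last two indices, with both leading pairs kept free.\<close>

definition riem_pairing :: "real^'m \<Rightarrow> 'm \<Rightarrow> 'm \<Rightarrow> 'm \<Rightarrow> 'm \<Rightarrow> real" where
  "riem_pairing x i j p q = trace (u x ** R p q x ** h x ** transpose (R i j x))"

text \<open>In the last pair the \<open>\<Omega>\<close> used for lowering cancels one used for
  raising, and since the curvature commutes with \<open>J\<close> what remains is the metric
  pairing. The pairing is linear in \<open>R p q x\<close>, so it inherits J-invariance in
  \<open>p\<close> and \<open>q\<close>.\<close>

lemma raise_riem:
  assumes x: "x \<in> S"
  shows "(\<^bold>\<Sum>i j k l p q r s. U x $ i $ p * U x $ j $ q * U x $ k $ r * U x $ l $ s *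
      riem_symp \<Omega> G x p q r s * riem_symp \<Omega> G x i j k l) =
    (\<^bold>\<Sum>i j p q. u x $ i $ p * u x $ j $ q * riem_pairing x i j p q)"
proof -
  have rs: "riem_symp \<Omega> G x i j k l = (R i j x ** W x) $ k $ l" for i j k l
    by (simp add: riem_symp_def mm_nth riem_matrix_def field_matrix_nth)
  have WU: "W x ** transpose (U x) = mat 1"
  proof -
    have "W x ** transpose (U x) = - (I x ** (h x ** u x) ** I x)"
      by (simp add: U_transpose[OF x] I_h[OF x, symmetric] mm_minus matrix_mul_assoc)
    then show ?thesis by (simp add: h_u[OF x] I_square[OF x])
  qed
  have inner: "(\<^bold>\<Sum>k l r s. U x $ k $ r * U x $ l $ s * (R p q x ** W x) $ r $ s * (R i j x ** W x) $ k $ l)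
      = riem_pairing x i j p q" for i j p q
  proof -
    have "(\<^bold>\<Sum>k l r s. U x $ k $ r * U x $ l $ s * (R p q x ** W x) $ r $ s * (R i j x ** W x) $ k $ l)
        = (\<^bold>\<Sum>k l. (\<^bold>\<Sum>r s. U x $ k $ r * U x $ l $ s * (R p q x ** W x) $ r $ s) * (R i j x ** W x) $ k $ l)"
      by (simp add: sum_distrib_right)
    also have "\<dots> = trace (U x ** (R p q x ** W x) ** transpose (U x) ** transpose (R i j x ** W x))"
      by (simp add: quad_sum trace_mult_transpose)
    also have "U x ** (R p q x ** W x) ** transpose (U x) = u x ** R p q x ** I x"
    proof -
      have "U x ** (R p q x ** W x) ** transpose (U x) = U x ** R p q x ** (W x ** transpose (U x))"
        by (simp add: matrix_mul_assoc)
      also have "\<dots> = u x ** (I x ** R p q x)"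
        by (simp add: WU matrix_mul_assoc)
      finally show ?thesis by (simp add: riem_I[OF x] matrix_mul_assoc)
    qed
    also have "u x ** R p q x ** I x ** transpose (R i j x ** W x)
        = u x ** R p q x ** (- (I x ** W x)) ** transpose (R i j x)"
      by (simp add: matrix_transpose_mul W_transpose[OF x] mm_minus matrix_mul_assoc)
    finally show ?thesis by (simp add: riem_pairing_def h_eq[OF x])
  qed
  have J_inv: "(\<^bold>\<Sum>a b. J x p a * J x q b * riem_pairing x i j a b) = riem_pairing x i j p q" for i j p q
  proof -
    have "R p q x = (\<Sum>a\<in>UNIV. \<Sum>b\<in>UNIV. (J x p a * J x q b) *\<^sub>R R a b x)"
      by (simp add: vec_eq_iff riem_matrix_def riem_J_invariant[OF x])
    then show ?thesis
      by (simp add: riem_pairing_def mm_sum mm_scale trace_sum trace_arith)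
  qed
  have "(\<^bold>\<Sum>i j k l p q r s. U x $ i $ p * U x $ j $ q * U x $ k $ r * U x $ l $ s *
      riem_symp \<Omega> G x p q r s * riem_symp \<Omega> G x i j k l)
    = (\<^bold>\<Sum>i j p q k l r s. U x $ i $ p * U x $ j $ q * U x $ k $ r * U x $ l $ s *
      riem_symp \<Omega> G x p q r s * riem_symp \<Omega> G x i j k l)"
    by (intro sum.cong refl sum_swap_pairs)
  also have "\<dots> = (\<^bold>\<Sum>i j p q. U x $ i $ p * U x $ j $ q * riem_pairing x i j p q)"
    by (simp only: rs inner[symmetric] sum_distrib_left mult.assoc)
  also have "\<dots> = (\<^bold>\<Sum>i j p q. u x $ i $ p * u x $ j $ q * riem_pairing x i j p q)"
    by (simp only: raise_J_invariant[OF x J_inv])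
  finally show ?thesis .
qed

lemma norm_sq31_eq:
  assumes x: "x \<in> S"
  shows "norm_sq31 g (riem G) x = (\<^bold>\<Sum>i j p q. u x $ i $ p * u x $ j $ q * riem_pairing x i j p q)"
proof -
  have inner: "(\<^bold>\<Sum>k l r s. u x $ k $ r * h x $ l $ s * riem G x p q r s * riem G x i j k l)
      = riem_pairing x i j p q" for i j p q
  proof -
    have "(\<^bold>\<Sum>k l r s. u x $ k $ r * h x $ l $ s * riem G x p q r s * riem G x i j k l)
        = (\<^bold>\<Sum>k l. (\<^bold>\<Sum>r s. u x $ k $ r * h x $ l $ s * riem G x p q r s) * R i j x $ k $ l)"
      by (simp add: sum_distrib_right riem_matrix_def)
    also have "\<dots> = trace (u x ** R p q x ** transpose (h x) ** transpose (R i j x))"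
      by (simp add: quad_sum trace_mult_transpose riem_matrix_def)
    finally show ?thesis by (simp add: riem_pairing_def h_transpose[OF x])
  qed
  have "norm_sq31 g (riem G) x = (\<^bold>\<Sum>i j k l p q r s.
      u x $ i $ p * u x $ j $ q * u x $ k $ r * h x $ l $ s * riem G x p q r s * riem G x i j k l)"
    by (simp add: norm_sq31_def metric_up_eq field_matrix_nth ac_simps)
  also have "\<dots> = (\<^bold>\<Sum>i j p q k l r s.
      u x $ i $ p * u x $ j $ q * u x $ k $ r * h x $ l $ s * riem G x p q r s * riem G x i j k l)"
    by (intro sum.cong refl sum_swap_pairs)
  also have "\<dots> = (\<^bold>\<Sum>i j p q. u x $ i $ p * u x $ j $ q * riem_pairing x i j p q)"
    by (simp only: inner[symmetric] sum_distrib_left mult.assoc)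
  finally show ?thesis .
qed

text \<open>The derivative of the Ricci tensor anticommutes with \<open>J\<close> in the sense of
  \<open>cov_ric_I\<close>. This shifts the \<open>J\<close> inside \<open>U\<close> to the free
  index \<open>i\<close> and leaves an ordinary metric divergence.\<close>

lemma symplectic_divergence_ric:
  assumes x: "x \<in> S"
  shows "trace (U x ** (\<chi> q j. cov_ric G q x $ i $ j)) = 1/2 * (\<^bold>\<Sum>b. J x i b * pd b (scal g G) x)"
proof -
  have U: "U x $ j $ q = - U x $ q $ j" for j q
    using U_transpose[OF x] by (metis transpose_nth vector_uminus_component)
  have q: "(\<^bold>\<Sum>j. U x $ q $ j * cov_ric G q x $ i $ j)
      = - (\<^bold>\<Sum>b j. J x i b * (u x $ q $ j * cov_ric G q x $ b $ j))" for q
  proof -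
    have "(\<^bold>\<Sum>j. U x $ q $ j * cov_ric G q x $ i $ j) = (U x ** transpose (cov_ric G q x)) $ q $ i"
      by (simp add: mm_nth[of "U x"] transpose_nth)
    also have "U x ** transpose (cov_ric G q x) = - (u x ** transpose (cov_ric G q x) ** transpose (I x))"
      by (simp add: cov_ric_transpose[OF x] cov_ric_I[OF x] mm_minus flip: matrix_mul_assoc)
    also have "(- (u x ** transpose (cov_ric G q x) ** transpose (I x))) $ q $ i
        = - (\<^bold>\<Sum>b j. J x i b * (u x $ q $ j * cov_ric G q x $ b $ j))"
      by (simp add: mm_nth transpose_nth field_matrix_nth sum_distrib_left ac_simps)
    finally show ?thesis .
  qed
  have "trace (U x ** (\<chi> q j. cov_ric G q x $ i $ j)) = (\<^bold>\<Sum>j q. - U x $ q $ j * cov_ric G q x $ i $ j)"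
    by (simp add: trace_mult U[symmetric])
  also have "\<dots> = (\<^bold>\<Sum>q j. - U x $ q $ j * cov_ric G q x $ i $ j)" by (rule sum.swap)
  also have "\<dots> = (\<^bold>\<Sum>q b j. J x i b * (u x $ q $ j * cov_ric G q x $ b $ j))"
    by (simp add: sum_negf q)
  also have "\<dots> = (\<^bold>\<Sum>b q j. J x i b * (u x $ q $ j * cov_ric G q x $ b $ j))"
    by (rule sum.swap)
  also have "\<dots> = (\<^bold>\<Sum>b. J x i b * (1/2 * pd b (scal g G) x))"
    by (simp only: contracted_bianchi[OF x] sum_distrib_left[symmetric])
  finally show ?thesis by (simp add: sum_distrib_left ac_simps)
qed

lemma smooth_scal: "smooth_on S (scal g G)"
proof (rule smooth_on_cong[OF open_S])
  show "smooth_on S (\<lambda>y. \<^bold>\<Sum>i j. u y $ i $ j * Rc y $ j $ i)"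
    using smoothm_u smoothm_Rc unfolding smoothm_def by (intro smooth_on_intros open_S) auto
qed (simp add: scal_eq trace_mult)

lemma double_divergence_ric:
  assumes x: "x \<in> S"
  shows "(\<^bold>\<Sum>i j p q. U x $ i $ p * U x $ j $ q * cov_3 G (cov_2 G (ric G)) x p q i j)
    = 1/2 * laplacian g G (scal g G) x"
proof -
  define f where "f = scal g G"
  define X where "X i y = (\<chi> q j. cov_ric G q y $ i $ j)" for i y
  define w where "w i y = trace (U y ** X i y)" for i y
  have sX: "smoothm S (X i)" for i
  proof -
    have "smoothm S (cov_ric G q)" for q
      unfolding cov_ric_matrix[abs_def]
      by (intro smoothm_intros smoothm_Rc smoothm_conn open_S)
    then show ?thesis by (simp add: smoothm_def X_def)
  qed
  have sU: "smoothm S U" by (intro smoothm_intros smoothm_u smoothm_I open_S)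
  have w: "w i y = 1/2 * (\<^bold>\<Sum>b. J y i b * pd b f y)" if "y \<in> S" for i y
    using symplectic_divergence_ric[OF that] by (simp add: w_def X_def f_def)
  define Z where "Z p c = cov_1 G (\<lambda>y k. pd k f y) x p c" for p c
  \<comment> \<open>Since \<open>U\<close> is parallel, the inner contraction commutes with the
    outer derivative; the remaining Christoffel term makes the right side the covariant derivative
    of the 1-form \<open>w\<close>.\<close>
  have 1: "(\<^bold>\<Sum>j q. U x $ j $ q * cov_3 G (cov_2 G (ric G)) x p q i j)
      = pd p (w i) x - (\<^bold>\<Sum>a. G x p i a * w a x)" for p i
  proof -
    have c3: "(\<chi> q j. cov_3 G (cov_2 G (ric G)) x p q i j) = pdm p (X i) x - \<Gamma> p x ** X i x
        - X i x ** transpose (\<Gamma> p x) - (\<Sum>a\<in>UNIV. G x p i a *\<^sub>R X a x)"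
      by (simp add: vec_eq_iff cov_3_def pdm_def X_def cov_ric_def mm_nth transpose_nth
          conn_matrix_def ac_simps)
    have "(\<^bold>\<Sum>j q. U x $ j $ q * cov_3 G (cov_2 G (ric G)) x p q i j)
        = trace (U x ** (\<chi> q j. cov_3 G (cov_2 G (ric G)) x p q i j))"
      by (simp add: trace_mult)
    also have "\<dots> = pd p (w i) x - (\<^bold>\<Sum>a. G x p i a * w a x)"
      unfolding c3 w_def pd_contract[OF sU sX x pdm_U[OF x]]
      by (simp add: mm_diff mm_sum mm_scale trace_sub trace_sum trace_arith)
    finally show ?thesis .
  qed
  \<comment> \<open>As \<open>J\<close> is parallel, differentiating \<open>w\<close> passes
    \<open>J\<close> by and yields the Hessian \<open>Z\<close> of the scalar curvature.\<close>
  have 2: "pd p (w i) x - (\<^bold>\<Sum>a. G x p i a * w a x) = 1/2 * (\<^bold>\<Sum>c. J x i c * Z p c)" for p i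
  proof -
    have dJ: "(\<lambda>y. J y i b) differentiable (at x)" for b
      using smooth_onD(1)[OF smooth_J x] .
    have df: "pd b f differentiable (at x)" for b
      using smooth_onD(2)[OF smooth_scal x] by (simp add: f_def)
    have "pd p (w i) x = pd p (\<lambda>y. 1/2 * (\<^bold>\<Sum>b. J y i b * pd b f y)) x"
      by (rule pd_cong[OF open_S x w])
    also have "\<dots> = 1/2 * pd p (\<lambda>y. \<^bold>\<Sum>b. J y i b * pd b f y) x"
      by (subst pd_mult) (auto simp: pd_const dJ df intro!: differentiable_mult)
    also have "pd p (\<lambda>y. \<^bold>\<Sum>b. J y i b * pd b f y) x
        = (\<^bold>\<Sum>b. pdm p I x $ i $ b * pd b f x) + (\<^bold>\<Sum>b. J x i b * pd p (pd b f) x)"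
      by (simp add: pd_sum pd_mult dJ df differentiable_mult sum.distrib pdm_def field_matrix_nth)
    also have "(\<^bold>\<Sum>b. pdm p I x $ i $ b * pd b f x)
        = (\<^bold>\<Sum>b a. G x p i a * (J x a b * pd b f x)) - (\<^bold>\<Sum>b c. J x i c * (G x p c b * pd b f x))"
      by (simp add: pdm_I[OF x] mm_nth conn_matrix_def field_matrix_nth left_diff_distrib
          sum_subtractf sum_distrib_right mult.assoc)
    also have "(\<^bold>\<Sum>b a. G x p i a * (J x a b * pd b f x)) = (\<^bold>\<Sum>a. G x p i a * (2 * w a x))"
      by (subst sum.swap) (simp add: w[OF x] flip: sum_distrib_left)
    also have "(\<^bold>\<Sum>b c. J x i c * (G x p c b * pd b f x)) = (\<^bold>\<Sum>c. J x i c * (\<^bold>\<Sum>b. G x p c b * pd b f x))"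
      by (subst sum.swap) (simp add: sum_distrib_left)
    also have "(\<^bold>\<Sum>a. G x p i a * (2 * w a x)) = 2 * (\<^bold>\<Sum>a. G x p i a * w a x)"
      by (simp add: sum_distrib_left ac_simps)
    finally have "pd p (w i) x = 1/2 * (2 * (\<^bold>\<Sum>a. G x p i a * w a x)
        - (\<^bold>\<Sum>c. J x i c * (\<^bold>\<Sum>b. G x p c b * pd b f x))
        + (\<^bold>\<Sum>c. J x i c * pd p (pd c f) x))" .
    moreover have "(\<^bold>\<Sum>c. J x i c * Z p c) = (\<^bold>\<Sum>c. J x i c * pd p (pd c f) x)
        - (\<^bold>\<Sum>c. J x i c * (\<^bold>\<Sum>b. G x p c b * pd b f x))"
      by (simp add: Z_def cov_1_def right_diff_distrib sum_subtractf)
    moreover have "w' - a = 1/2 * z" if "w' = 1/2 * (2 * a - b + d)" "z = d - b" for w' a b d z :: real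
      using that by simp
    ultimately show ?thesis by blast
  qed
  have "(\<^bold>\<Sum>i j p q. U x $ i $ p * U x $ j $ q * cov_3 G (cov_2 G (ric G)) x p q i j)
      = (\<^bold>\<Sum>i p j q. U x $ i $ p * U x $ j $ q * cov_3 G (cov_2 G (ric G)) x p q i j)"
    by (intro sum.cong refl sum.swap)
  also have "\<dots> = (\<^bold>\<Sum>i p. U x $ i $ p * (1/2 * (\<^bold>\<Sum>c. J x i c * Z p c)))"
    by (simp only: 1 2 sum_distrib_left[symmetric] mult.assoc)
  also have "\<dots> = (\<^bold>\<Sum>i p c. 1/2 * (J x i c * U x $ i $ p * Z p c))"
    by (simp add: sum_distrib_left ac_simps)
  also have "\<dots> = (\<^bold>\<Sum>p i c. 1/2 * (J x i c * U x $ i $ p * Z p c))" by (rule sum.swap)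
  also have "\<dots> = (\<^bold>\<Sum>p c i. 1/2 * (J x i c * U x $ i $ p * Z p c))"
    by (intro sum.cong refl sum.swap)
  also have "\<dots> = (\<^bold>\<Sum>p c. 1/2 * ((transpose (I x) ** U x) $ c $ p * Z p c))"
    by (simp add: mm_nth[of "transpose (I x)"] transpose_nth field_matrix_nth sum_distrib_right sum_distrib_left)
  also have "\<dots> = (\<^bold>\<Sum>p c. 1/2 * (u x $ p $ c * Z p c))"
    by (simp only: I_u_I[OF x] u_sym[OF x])
  finally show ?thesis
    by (simp add: laplacian_def metric_up_eq Z_def f_def sum_distrib_left)
qed

lemma K_map_eq:
  assumes x: "x \<in> S"
  shows "2 * K_map \<Omega> G x = laplacian g G (scal g G) x - norm_sq2 g (ric G) x
    + 1/2 * norm_sq31 g (riem G) x"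
  unfolding K_map_def Let_def symp_up_eq[OF x] double_divergence_ric[OF x] raise_ric[OF x]
    raise_riem[OF x] norm_sq31_eq[OF x] by simp

subsection \<open>The norm of the Weyl tensor\<close>

lemma norm_sq2_ip2: "norm_sq2 g T x = ip2 (u x) (T x) (T x)"
  by (simp add: norm_sq2_def ip2_def metric_up_eq)

lemma ip2_ric_g: "x \<in> S \<Longrightarrow> ip2 (u x) (ric G x) (g x) = scal g G x"
  and ip2_g_ric: "x \<in> S \<Longrightarrow> ip2 (u x) (g x) (ric G x) = scal g G x"
  and ip2_g_g: "x \<in> S \<Longrightarrow> ip2 (u x) (g x) (g x) = real CARD('m)"
proof -
  assume x: "x \<in> S"
  have t: "(\<chi> p q. g x p q) = h x" "(\<chi> p q. ric G x p q) = Rc x"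
    by (simp_all add: field_matrix_def)
  show "ip2 (u x) (ric G x) (g x) = scal g G x"
    by (simp add: ip2_trace t u_h Rc_transpose u_transpose scal_eq x)
  have "trace (u x ** Rc x ** u x ** h x) = trace (u x ** Rc x)"
    by (simp add: u_h[OF x] flip: matrix_mul_assoc)
  then show "ip2 (u x) (g x) (ric G x) = scal g G x"
    by (simp add: ip2_trace t h_transpose u_transpose scal_eq x)
  show "ip2 (u x) (g x) (g x) = real CARD('m)"
    by (simp add: ip2_trace t h_transpose u_transpose u_h x trace_I)
qed

lemma norm_tracefree_ric:
  assumes x: "x \<in> S" and n: "CARD('m) = 2 * n"
  shows "norm_sq2 g (tracefree_ric n g G) x = norm_sq2 g (ric G) x - (scal g G x)\<^sup>2 / (2 * real n)"
proof -
  define c where "c = 1 / (2 * real n) * scal g G x"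
  have "n > 0" using n zero_less_card_finite[where 'a='m] by simp
  then have c: "c * real CARD('m) = scal g G x" by (simp add: c_def n)
  have E: "tracefree_ric n g G x = (\<lambda>i j. ric G x i j - c * g x i j)"
    by (simp add: fun_eq_iff tracefree_ric_def c_def)
  have 1: "ip2 (u x) Q (\<lambda>i j. ric G x i j - c * g x i j) = ip2 (u x) Q (ric G x) - c * ip2 (u x) Q (g x)" for Q
    using ip2_right_diff[of "u x" Q 1 "ric G x" c "g x"] by simp
  have "norm_sq2 g (tracefree_ric n g G) x = norm_sq2 g (ric G) x - c * scal g G x
      - c * (scal g G x - c * real CARD('m))"
    by (simp only: norm_sq2_ip2 E ip2_left_diff 1 ip2_ric_g[OF x] ip2_g_ric[OF x] ip2_g_g[OF x])
  then show ?thesis unfolding c by (simp add: c_def power2_eq_square)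
qed

lemma norm_riem_low:
  assumes x: "x \<in> S"
  shows "ip4 (u x) (riem_low x) (riem_low x) = norm_sq31 g (riem G) x"
proof -
  have inner: "(\<^bold>\<Sum>k l r s. u x $ k $ r * u x $ l $ s * riem_low x p q r s * riem_low x i j k l)
      = riem_pairing x i j p q" for i j p q
  proof -
    have "(\<^bold>\<Sum>k l r s. u x $ k $ r * u x $ l $ s * riem_low x p q r s * riem_low x i j k l)
        = ip2 (u x) (riem_low x i j) (riem_low x p q)"
      by (simp add: ip2_def ac_simps)
    also have "\<dots> = trace (u x ** (R p q x ** h x) ** u x ** transpose (R i j x ** h x))"
      by (simp add: ip2_trace riem_low_def u_transpose[OF x])
    also have "\<dots> = trace (u x ** R p q x ** h x ** (u x ** h x) ** transpose (R i j x))"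
      by (simp add: matrix_transpose_mul h_transpose[OF x] matrix_mul_assoc)
    finally show ?thesis by (simp add: riem_pairing_def u_h[OF x])
  qed
  have "ip4 (u x) (riem_low x) (riem_low x) = (\<^bold>\<Sum>i j k l p q r s.
      u x $ i $ p * u x $ j $ q * u x $ k $ r * u x $ l $ s * riem_low x p q r s * riem_low x i j k l)"
    by (simp add: ip4_def ac_simps)
  also have "\<dots> = (\<^bold>\<Sum>i j p q k l r s.
      u x $ i $ p * u x $ j $ q * u x $ k $ r * u x $ l $ s * riem_low x p q r s * riem_low x i j k l)"
    by (intro sum.cong refl sum_swap_pairs)
  also have "\<dots> = (\<^bold>\<Sum>i j p q. u x $ i $ p * u x $ j $ q * riem_pairing x i j p q)"
    by (simp only: inner[symmetric] sum_distrib_left mult.assoc)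
  finally show ?thesis by (simp add: norm_sq31_eq[OF x])
qed

text \<open>The Ricci tensor pairs the first index with the upper one, whereas here the first is
  paired with the third; skewness in the last pair accounts for the sign.\<close>

lemma trace_riem_low:
  assumes x: "x \<in> S"
  shows "(\<^bold>\<Sum>i k. u x $ i $ k * riem_low x i j k l) = - ric G x j l"
proof -
  have "(\<^bold>\<Sum>i k. u x $ i $ k * riem_low x i j k l) = (\<^bold>\<Sum>i k. - (riem_low x i j l k * u x $ k $ i))"
  proof (intro sum.cong refl)
    fix i k
    show "u x $ i $ k * riem_low x i j k l = - (riem_low x i j l k * u x $ k $ i)"
      by (simp add: riem_low_antisym34[OF x, of i j k l] u_sym[OF x, of i k])
  qed
  then show ?thesis by (simp add: sum_negf ric_def riem_raise[OF x])
qed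

lemma trace_kulkarni:
  assumes x: "x \<in> S"
  shows "(\<^bold>\<Sum>i k. u x $ i $ k * kulkarni (h x) P i j k l)
    = (real CARD('m) - 2) * P j l + (\<^bold>\<Sum>i k. u x $ i $ k * P i k) * h x $ j $ l"
proof -
  have hs: "h x $ a $ b = h x $ b $ a" for a b by (simp add: field_matrix_nth g_sym[OF x, of a b])
  have uh: "(\<^bold>\<Sum>k. u x $ i $ k * h x $ k $ j) = (if i = j then 1 else 0)" for i j
    using u_h[OF x] by (simp add: mat_def flip: mm_nth)
  have 1: "(\<^bold>\<Sum>i k. u x $ i $ k * (h x $ k $ i * P j l)) = real CARD('m) * P j l"
    by (simp add: uh flip: sum_distrib_right mult.assoc)
  have 2: "(\<^bold>\<Sum>i k. u x $ i $ k * (h x $ k $ j * P i l)) = P j l"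
    by (simp add: uh if_distrib[of "\<lambda>z. z * _"] cong: if_cong flip: sum_distrib_right mult.assoc)
  have "(\<^bold>\<Sum>i k. u x $ i $ k * (h x $ l $ i * P j k)) = (\<^bold>\<Sum>k i. u x $ k $ i * h x $ i $ l * P j k)"
    by (subst sum.swap) (simp add: u_sym[OF x] hs[of l] mult.assoc)
  then have 3: "(\<^bold>\<Sum>i k. u x $ i $ k * (h x $ l $ i * P j k)) = P j l"
    by (simp add: uh if_distrib[of "\<lambda>z. z * _"] cong: if_cong flip: sum_distrib_right)
  have 4: "(\<^bold>\<Sum>i k. u x $ i $ k * (h x $ l $ j * P i k)) = (\<^bold>\<Sum>i k. u x $ i $ k * P i k) * h x $ j $ l"
    by (simp add: hs[of l j] sum_distrib_left ac_simps)
  show ?thesis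
    by (simp only: kulkarni_def distrib_left right_diff_distrib sum.distrib sum_subtractf 1 2 3 4)
      (simp add: algebra_simps)
qed

lemma norm_weyl:
  assumes x: "x \<in> S" and n: "CARD('m) = 2 * n" "n \<ge> 2"
  shows "norm_sq4 g (weyl n g G) x = norm_sq31 g (riem G) x - 2 / (real n - 1) * norm_sq2 g (ric G) x
    + (scal g G x)\<^sup>2 / ((real n - 1) * (2 * real n - 1))"
proof -
  define s where "s = scal g G x"
  \<comment> \<open>With these constants \<open>P\<close> is the Schouten tensor in dimension
    \<open>2 * n\<close>: they are what makes the contraction \<open>tA\<close> vanish.\<close>
  define c where "c = 1 / (2 * (real n - 1))"
  define d where "d = s / (4 * (real n - 1) * (2 * real n - 1))"
  define P where "P = (\<lambda>j l. c * ric G x j l - d * g x j l)"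
  define Q where "Q = kulkarni (h x) P"
  define A where "A = (\<lambda>i j k l. riem_low x i j k l + Q i j k l)"
  have n': "real n - 1 > 0" "2 * real n - 1 > 0" using n by auto
  have "weyl n g G x = A"
  proof (intro ext)
    fix i j k l
    have coeffs: "1 / (real n - 1) = 2 * c"
      "1 / ((real n - 1) * (2 * real n - 1)) * scal g G x = 4 * d"
      by (simp_all add: c_def d_def s_def mult.assoc del: right_diff_distrib_numeral)
    show "weyl n g G x i j k l = A i j k l"
      unfolding weyl_def Let_def coeffs
      by (simp add: A_def Q_def kulkarni_def P_def riem_low_def mm_nth riem_matrix_def
          field_matrix_nth g_sym[OF x, of j l] g_sym[OF x, of j k] g_sym[OF x, of i l]
          g_sym[OF x, of i k] algebra_simps)
  qed
  then have norm: "norm_sq4 g (weyl n g G) x = ip4 (u x) A A"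
    by (simp add: norm_sq4_def ip4_def metric_up_eq)
  have A1: "A i j k l = - A j i k l" for i j k l
    using riem_low_antisym12[of x i j k l] by (simp add: A_def Q_def kulkarni_def)
  have A2: "A i j k l = - A i j l k" for i j k l
    using riem_low_antisym34[OF x, of i j k l] by (simp add: A_def Q_def kulkarni_def)
  have sP: "(\<^bold>\<Sum>i k. u x $ i $ k * P i k) = s / (2 * (2 * real n - 1))"
  proof -
    have "(\<^bold>\<Sum>i k. u x $ i $ k * g x k i) = real CARD('m)"
      using trace_mult[of "u x" "h x"] by (simp add: u_h[OF x] trace_I field_matrix_nth)
    then have "(\<^bold>\<Sum>i k. u x $ i $ k * g x i k) = real CARD('m)"
      by (simp add: g_sym[OF x])
    moreover have "(\<^bold>\<Sum>i k. u x $ i $ k * ric G x i k) = s"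
      by (simp add: s_def scal_def metric_up_eq)
    moreover have "(\<^bold>\<Sum>i k. u x $ i $ k * P i k)
        = c * (\<^bold>\<Sum>i k. u x $ i $ k * ric G x i k) - d * (\<^bold>\<Sum>i k. u x $ i $ k * g x i k)"
      by (simp add: P_def right_diff_distrib sum_subtractf sum_distrib_left ac_simps)
    ultimately have "(\<^bold>\<Sum>i k. u x $ i $ k * P i k) = c * s - d * (2 * real n)" by (simp add: n)
    also have "\<dots> = s / (2 * (2 * real n - 1))"
      using n' by (simp add: c_def d_def divide_simps) (simp add: algebra_simps)
    finally show ?thesis .
  qed
  have tA: "(\<^bold>\<Sum>i k. u x $ i $ k * A i j k l) = 0" for j l
  proof -
    have "(\<^bold>\<Sum>i k. u x $ i $ k * A i j k l) = - ric G x j l + ((real CARD('m) - 2) * P j l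
        + s / (2 * (2 * real n - 1)) * h x $ j $ l)"
      by (simp only: A_def distrib_left sum.distrib trace_riem_low[OF x] Q_def trace_kulkarni[OF x] sP)
    also have "\<dots> = 0"
      using n' by (simp add: n P_def c_def d_def field_matrix_nth divide_simps) (simp add: algebra_simps)
    finally show ?thesis .
  qed
  note us = u_sym[OF x]
  have "ip4 (u x) A Q = 0"
    by (simp add: Q_def ip4_kulkarni[OF us u_h[OF x] A1 A2] tA ip2_def)
  \<comment> \<open>As \<open>A\<close> is orthogonal to its correction \<open>Q\<close>, one factor
    \<open>A\<close> may be replaced by the curvature; expanding the other leaves only the product
    of \<open>Q\<close> with the curvature.\<close>
  then have "ip4 (u x) A A = ip4 (u x) A (riem_low x)"
    using ip4_add_right[of "u x" A "riem_low x" Q] by (simp flip: A_def)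
  also have "\<dots> = ip4 (u x) (riem_low x) A" by (rule ip4_swap[OF us])
  also have "\<dots> = ip4 (u x) (riem_low x) (riem_low x) + ip4 (u x) (riem_low x) Q"
    unfolding A_def by (rule ip4_add_right)
  also have "ip4 (u x) (riem_low x) Q = 4 * ip2 (u x) (\<lambda>j l. - ric G x j l) P"
    unfolding Q_def
    by (simp add: ip4_kulkarni[OF us u_h[OF x] riem_low_antisym12 riem_low_antisym34[OF x]]
        trace_riem_low[OF x])
  also have "ip2 (u x) (\<lambda>j l. - ric G x j l) P = - ip2 (u x) (ric G x) P"
    by (simp add: ip2_def sum_negf)
  also have "ip2 (u x) (ric G x) P = c * norm_sq2 g (ric G) x - d * s"
    by (simp add: P_def ip2_right_diff norm_sq2_ip2 ip2_ric_g[OF x] s_def)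
  finally have A: "ip4 (u x) A A = norm_sq31 g (riem G) x
      - 4 * c * norm_sq2 g (ric G) x + 4 * d * s"
    by (simp add: norm_riem_low[OF x])
  have coeffs: "2 / (real n - 1) = 4 * c" "s\<^sup>2 / ((real n - 1) * (2 * real n - 1)) = 4 * d * s"
    by (simp_all add: c_def d_def power2_eq_square mult.assoc del: right_diff_distrib_numeral)
  show ?thesis
    unfolding norm A s_def[symmetric] coeffs ..
qed

end

section \<open>The three formulas in an arbitrary chart\<close>

theorem lemma1p10:
  fixes M :: "'a topology"
    and A :: "('a, 'm::finite) chart set"
    and g J \<Omega> :: "('a, 'm) chart \<Rightarrow> 'm comp2"
    and \<Gamma> :: "('a, 'm) chart \<Rightarrow> 'm comp3"
    and n :: nat
  assumes dim: "CARD('m) = 2 * n"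
    and manifold: "smooth_atlas M A"
    and kaehler: "kaehler_structure A g J \<Omega>"
    and connection: "levi_civita A g \<Gamma>"
  shows "\<forall>c\<in>A. \<forall>x\<in>img_of c.
    2 * K_map (\<Omega> c) (\<Gamma> c) x =
      laplacian (g c) (\<Gamma> c) (scal (g c) (\<Gamma> c)) x
      - norm_sq2 (g c) (ric (\<Gamma> c)) x
      + 1/2 * norm_sq31 (g c) (riem (\<Gamma> c)) x
    \<and> (n \<ge> 2 \<longrightarrow>
        2 * K_map (\<Omega> c) (\<Gamma> c) x =
          laplacian (g c) (\<Gamma> c) (scal (g c) (\<Gamma> c)) x
          + 1/2 * norm_sq4 (g c) (weyl n (g c) (\<Gamma> c)) x
          - (real n - 2) / (real n - 1) * norm_sq2 (g c) (tracefree_ric n (g c) (\<Gamma> c)) x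
          - (real n - 1) / (real n * (2 * real n - 1)) * (scal (g c) (\<Gamma> c) x)\<^sup>2
        \<and>
        2 * K_map (\<Omega> c) (\<Gamma> c) x =
          conformal_laplacian n (g c) (\<Gamma> c) (scal (g c) (\<Gamma> c)) x
          + 1/2 * norm_sq4 (g c) (weyl n (g c) (\<Gamma> c)) x
          - (real n - 2) / (real n - 1) * norm_sq2 (g c) (tracefree_ric n (g c) (\<Gamma> c)) x
          + (real n - 1) * (real n - 2) / (2 * real n * (2 * real n - 1)) * (scal (g c) (\<Gamma> c) x)\<^sup>2)"
proof (intro ballI)
  fix c x assume c: "c \<in> A" and x: "x \<in> img_of c"
  have sympl: "symplectic_form A \<Omega>" and compl: "integrable_complex_structure A J"
    using kaehler by (simp_all add: kaehler_structure_def)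
  interpret kaehler_chart "img_of c" "\<Gamma> c" "g c" "J c" "\<Omega> c"
  proof unfold_locales
    show "open (img_of c)" using manifold c by (simp add: smooth_atlas_def)
    show "smooth_on (img_of c) (\<lambda>y. \<Gamma> c y i j k)" for i j k
      using connection c by (simp add: levi_civita_def affine_connection_def)
    show "\<Gamma> c y i j k = \<Gamma> c y j i k" if "y \<in> img_of c" for y i j k
      using connection c that unfolding levi_civita_def torsion_free_def by blast
    show "smooth_on (img_of c) (\<lambda>y. J c y i j)" for i j
      using compl c by (simp add: integrable_complex_structure_def endomorphism_field_def)
    show "smooth_on (img_of c) (\<lambda>y. \<Omega> c y i j)" for i j
      using sympl c by (simp add: symplectic_form_def covariant2_field_def)
  next
    fix y i j k assume y: "y \<in> img_of c"
    show "\<Omega> c y i j = - \<Omega> c y j i"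
      "pd i (\<lambda>y. \<Omega> c y j k) y + pd j (\<lambda>y. \<Omega> c y k i) y + pd k (\<lambda>y. \<Omega> c y i j) y = 0"
      using sympl c y unfolding symplectic_form_def by blast+
    show "(\<^bold>\<Sum>p. J c y i p * J c y p j) = (if i = j then - 1 else 0)" "nijenhuis (J c) y i j k = 0"
      using compl c y unfolding integrable_complex_structure_def by blast+
    show "g c y i j = - (\<^bold>\<Sum>p. J c y i p * \<Omega> c y p j)" "g c y i j = g c y j i"
      using kaehler c y unfolding kaehler_structure_def by blast+
    show "cov_2 (\<Gamma> c) (g c) y i j k = 0"
      using connection c y unfolding levi_civita_def by blast
  next
    show "0 < (\<^bold>\<Sum>i j. X i * X j * g c y i j)" if "y \<in> img_of c" "\<exists>i. X i \<noteq> 0" for y X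
      using kaehler c that unfolding kaehler_structure_def by blast
  qed
  let ?s = "scal (g c) (\<Gamma> c) x" and ?L = "laplacian (g c) (\<Gamma> c) (scal (g c) (\<Gamma> c)) x"
  let ?N = "norm_sq2 (g c) (ric (\<Gamma> c)) x" and ?R = "norm_sq31 (g c) (riem (\<Gamma> c)) x"
  \<comment> \<open>Here \<open>m\<close>, \<open>N\<close>, \<open>r\<close> and \<open>t\<close>
    stand for the complex dimension, the squared norms of Ricci and Riemann, and the squared scalar
    curvature. The right side is the Weyl formula after inserting both norms.\<close>
  have arith1: "- N + 1/2 * r = 1/2 * (r - 2 / (m - 1) * N + t / ((m - 1) * (2 * m - 1)))
      - (m - 2) / (m - 1) * (N - t / (2 * m)) - (m - 1) / (m * (2 * m - 1)) * t"
    if "m \<ge> 2" for N r t m :: real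
  proof -
    have "m - 1 \<noteq> 0" "2 * m - 1 \<noteq> 0" "m \<noteq> 0" using that by auto
    then show ?thesis by (simp add: divide_simps) algebra
  qed
  \<comment> \<open>The last two formulas differ only by the zeroth order term of the conformal
    Laplacian, here absorbed into the coefficient of the squared scalar curvature.\<close>
  have arith2: "- ((m - 1) / (m * (2 * m - 1)) * t)
      = - ((m - 1) / (2 * (2 * m - 1)) * t) + (m - 1) * (m - 2) / (2 * m * (2 * m - 1)) * t"
    if "m \<ge> 2" for t m :: real
  proof -
    have "2 * m - 1 \<noteq> 0" "m \<noteq> 0" using that by auto
    then show ?thesis by (simp add: divide_simps) algebra
  qed
  show "2 * K_map (\<Omega> c) (\<Gamma> c) x = ?L - ?N + 1/2 * ?R \<and> (n \<ge> 2 \<longrightarrow>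
        2 * K_map (\<Omega> c) (\<Gamma> c) x =
          ?L + 1/2 * norm_sq4 (g c) (weyl n (g c) (\<Gamma> c)) x
          - (real n - 2) / (real n - 1) * norm_sq2 (g c) (tracefree_ric n (g c) (\<Gamma> c)) x
          - (real n - 1) / (real n * (2 * real n - 1)) * ?s\<^sup>2
        \<and>
        2 * K_map (\<Omega> c) (\<Gamma> c) x =
          conformal_laplacian n (g c) (\<Gamma> c) (scal (g c) (\<Gamma> c)) x
          + 1/2 * norm_sq4 (g c) (weyl n (g c) (\<Gamma> c)) x
          - (real n - 2) / (real n - 1) * norm_sq2 (g c) (tracefree_ric n (g c) (\<Gamma> c)) x
          + (real n - 1) * (real n - 2) / (2 * real n * (2 * real n - 1)) * ?s\<^sup>2)"
  proof (intro conjI impI)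
    show K: "2 * K_map (\<Omega> c) (\<Gamma> c) x = ?L - ?N + 1/2 * ?R"
      by (rule K_map_eq[OF x])
    assume n: "n \<ge> 2"
    show K': "2 * K_map (\<Omega> c) (\<Gamma> c) x =
          ?L + 1/2 * norm_sq4 (g c) (weyl n (g c) (\<Gamma> c)) x
          - (real n - 2) / (real n - 1) * norm_sq2 (g c) (tracefree_ric n (g c) (\<Gamma> c)) x
          - (real n - 1) / (real n * (2 * real n - 1)) * ?s\<^sup>2"
      unfolding K norm_weyl[OF x dim n] norm_tracefree_ric[OF x dim]
      using arith1[of "real n" ?N ?R "?s\<^sup>2"] n by linarith
    show "2 * K_map (\<Omega> c) (\<Gamma> c) x =
          conformal_laplacian n (g c) (\<Gamma> c) (scal (g c) (\<Gamma> c)) x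
          + 1/2 * norm_sq4 (g c) (weyl n (g c) (\<Gamma> c)) x
          - (real n - 2) / (real n - 1) * norm_sq2 (g c) (tracefree_ric n (g c) (\<Gamma> c)) x
          + (real n - 1) * (real n - 2) / (2 * real n * (2 * real n - 1)) * ?s\<^sup>2"
    proof -
      have "conformal_laplacian n (g c) (\<Gamma> c) (scal (g c) (\<Gamma> c)) x
          = ?L - (real n - 1) / (2 * (2 * real n - 1)) * ?s\<^sup>2"
        by (simp add: conformal_laplacian_def power2_eq_square)
      then show ?thesis
        unfolding K' using arith2[of "real n" "?s\<^sup>2"] n by linarith
    qed
  qed
qed

end
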